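(* Let $F=\{f_1,\dots,f_n\}$ be an (ordered) basis for an $n$-dimensional real vector space $V$ and fix an integer $t>0$. (1) If $\mathcal A\subseteq 2^{[n]}$ is a $t$-intersecting hypergraph, then the corresponding monomial subspace $F(\mathcal A)\subseteq\bigwedge V$ is $t$-self-annihilating. (2) If $W\subseteq\bigwedge V$ is a $t$-self-annihilating subspace, then the initial hypergraph $\mathcal H_F(W)$ is $t$-intersecting.
   Context: A hypergraph on $[n]=\{1,\dots,n\}$ is a set $\mathcal A$ of subsets of $[n]$; it is $t$-intersecting if $|A\cap B|\ge t$ for all $A,B\in\mathcal A$ (including $A=B$). For $A\subseteq[n]$, $f_A=\bigwedge_{a\in A}f_a$ with the elements of $A$ in increasing order ($f_\emptyset=1$); the $f_A$ form a basis of $\bigwedge V$. $F(\mathcal A)=\operatorname{span}\{f_A:A\in\mathcal A\}$. Order the subsets of $[n]$ by: $A>B$ if and only if $|A|>|B|$, or $|A|=|B|$, $A\neq B$ and $\max(A\,\Delta\,B)\in B$. For non-zero $w=\sum_{A\subseteq[n]}m_Af_A\in\bigwedge V$, the initial set is $\mathrm{ins}_F(w)=\max\{A:m_A\ne0\}$ in this order, and for a subspace $W\subseteq\bigwedge V$, $\mathcal H_F(W)=\{\mathrm{ins}_F(w):w\in W,\ w\neq0\}$. $\bigwedge V^*$ is identified with the dual of $\bigwedge V$: different degrees pair to zero, and $\langle v_1\wedge\dots\wedge v_k,\,w_1^*\wedge\dots\wedge w_k^*\rangle=\det(w_j^*(v_i))$. The interior product $\llcorner:\bigwedge V\times\bigwedge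 V^*\to\bigwedge V$ is the bilinear map defined by $\langle v\llcorner w^*,u^*\rangle=\langle v,w^*\wedge u^*\rangle$ for all $v\in\bigwedge V$, $w^*,u^*\in\bigwedge V^*$. An element of $\bigwedge^r V^*$ is decomposable if it has the form $y_1^*\wedge\dots\wedge y_r^*$ with $y_i^*\in V^*$ (scalars, of degree $0$, count as decomposable). A subspace $W\subseteq\bigwedge V$ is $t$-self-annihilating if $(u\llcorner y^* )\wedge(w\llcorner y^* )=0$ for all $u,w\in W$ and every decomposable $y^*\in\bigwedge^r V^*$ with $0\le r<t$. *)

theory Defs
  imports
    Complex_Main
    "HOL-Library.Poly_Mapping"
    "Jordan_Normal_Form.Determinant"
begin

section \<open>The exterior algebra of a real vector space\<close>

text \<open>
  The tensor algebra of \<open>V\<close> is presented as the free associative algebra on the underlying set of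
  \<open>V\<close> (finitely supported functions on words, multiplied by convolution) modulo linearity of the
  letters. Adding the relations \<open>v * v = 0\<close> yields the exterior algebra.
\<close>

datatype 'v word = Word (letters: "'v list")

instantiation word :: (type) monoid_add
begin

definition zero_word :: "'a word" where "0 = Word []"

definition plus_word :: "'a word \<Rightarrow> 'a word \<Rightarrow> 'a word"
  where "x + y = Word (letters x @ letters y)"

instance
  by standard (simp_all add: zero_word_def plus_word_def)

end

lemma letters_simps [simp]:
  "letters 0 = []" "letters (x + y) = letters x @ letters y"
  by (simp_all add: zero_word_def plus_word_def)

lemma word_sum_eq_0_iff: "(x + y = (0 :: 'v word)) \<longleftrightarrow> x = 0 \<and> y = 0"
  by (cases x; cases y) (auto simp: zero_word_def plus_word_def)

type_synonym 'v free_alg = "'v word \<Rightarrow>\<^sub>0 real"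

abbreviation letter :: "'v \<Rightarrow> 'v free_alg"
  where "letter v \<equiv> Poly_Mapping.single (Word [v]) 1"

abbreviation scal :: "real \<Rightarrow> 'v free_alg"
  where "scal c \<equiv> Poly_Mapping.single 0 c"

inductive_set ext_ideal :: "'v::real_vector free_alg set" where
  zero: "0 \<in> ext_ideal"
| letter_add: "letter (v + w) - letter v - letter w \<in> ext_ideal"
| letter_scale: "letter (c *\<^sub>R v) - scal c * letter v \<in> ext_ideal"
| square: "letter v * letter v \<in> ext_ideal"
| sum: "p \<in> ext_ideal \<Longrightarrow> q \<in> ext_ideal \<Longrightarrow> p + q \<in> ext_ideal"
| mult: "p \<in> ext_ideal \<Longrightarrow> a * p * b \<in> ext_ideal"

lemma ext_ideal_uminus: "p \<in> ext_ideal \<Longrightarrow> - p \<in> ext_ideal"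
  using ext_ideal.mult[of p "-1" 1] by simp

lemma ext_ideal_diff: "p \<in> ext_ideal \<Longrightarrow> q \<in> ext_ideal \<Longrightarrow> p - q \<in> ext_ideal"
  using ext_ideal.sum[of p "- q"] ext_ideal_uminus[of q] by simp

lemma ext_ideal_left: "p \<in> ext_ideal \<Longrightarrow> a * p \<in> ext_ideal"
  using ext_ideal.mult[of p a 1] by simp

lemma ext_ideal_right: "p \<in> ext_ideal \<Longrightarrow> p * a \<in> ext_ideal"
  using ext_ideal.mult[of p 1 a] by simp


subsection \<open>Linear functionals on words\<close>

definition lin_ext :: "('v word \<Rightarrow> real) \<Rightarrow> 'v free_alg \<Rightarrow> real"
  where "lin_ext g p = (\<Sum>a\<in>Poly_Mapping.keys p. Poly_Mapping.lookup p a * g a)"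

lemma lin_ext_superset:
  assumes "finite S" "Poly_Mapping.keys p \<subseteq> S"
  shows "lin_ext g p = (\<Sum>a\<in>S. Poly_Mapping.lookup p a * g a)"
  unfolding lin_ext_def
  by (rule sum.mono_neutral_left) (use assms in \<open>auto simp: in_keys_iff\<close>)

lemma lin_ext_add: "lin_ext g (p + q) = lin_ext g p + lin_ext g q"
proof -
  let ?S = "Poly_Mapping.keys p \<union> Poly_Mapping.keys q"
  have "Poly_Mapping.keys (p + q) \<subseteq> ?S" by (rule Poly_Mapping.keys_add)
  then show ?thesis
    by (simp add: lin_ext_superset[of ?S] lookup_add distrib_right sum.distrib)
qed

lemma lin_ext_0 [simp]: "lin_ext g 0 = 0"
  by (simp add: lin_ext_def)

lemma lin_ext_uminus: "lin_ext g (- p) = - lin_ext g p"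
  using lin_ext_add[of g p "- p"] by simp

lemma lin_ext_diff: "lin_ext g (p - q) = lin_ext g p - lin_ext g q"
  using lin_ext_add[of g p "- q"] by (simp add: lin_ext_uminus)

lemma lin_ext_single [simp]: "lin_ext g (Poly_Mapping.single a c) = c * g a"
  by (simp add: lin_ext_def)

lemma lin_ext_fun_add: "lin_ext (\<lambda>x. g x + h x) p = lin_ext g p + lin_ext h p"
  by (simp add: lin_ext_def distrib_left sum.distrib)

lemma lin_ext_fun_scale: "lin_ext (\<lambda>x. c * g x) p = c * lin_ext g p"
  by (simp add: lin_ext_def sum_distrib_left mult.left_commute)

lemma free_alg_induct [case_names single add]:
  fixes p :: "'v free_alg"
  assumes "\<And>a c. P (Poly_Mapping.single a c)" "\<And>p q. P p \<Longrightarrow> P q \<Longrightarrow> P (p + q)"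
  shows "P p"
proof (induction p rule: update_induct)
  case const
  show ?case using assms(1)[of undefined 0] by simp
next
  case (update f a b)
  have "Poly_Mapping.update a b f = f + Poly_Mapping.single a b"
    by (rule poly_mapping_eqI)
      (use update in \<open>auto simp: lookup_update lookup_add lookup_single in_keys_iff when_def\<close>)
  with update assms show ?case by simp
qed

lemma lin_ext_scal_mult: "lin_ext g (scal c * p) = c * lin_ext g p"
  by (induction p rule: free_alg_induct) (simp_all add: mult_single lin_ext_add distrib_left)

lemma scal_commute: "scal c * p = p * scal c"
  by (induction p rule: free_alg_induct)
    (simp_all add: mult_single distrib_left distrib_right mult.commute)

lemma lin_ext_ideal:
  fixes g :: "'v::real_vector word \<Rightarrow> real"
  assumes "p \<in> ext_ideal"
    and "\<And>x y v w. g (x + Word [v + w] + y) = g (x + Word [v] + y) + g (x + Word [w] + y)"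
    and "\<And>x y v c. g (x + Word [c *\<^sub>R v] + y) = c * g (x + Word [v] + y)"
    and "\<And>x y v. g (x + Word [v, v] + y) = 0"
  shows "lin_ext g p = 0"
  using assms
proof (induction arbitrary: g)
  case (letter_add v w)
  show ?case using letter_add(1)[of 0 v w 0] by (simp add: lin_ext_diff)
next
  case (letter_scale c v)
  show ?case using letter_scale(2)[of 0 c v 0] by (simp add: lin_ext_diff mult_single)
next
  case (square v)
  show ?case using square(3)[of 0 v 0] by (simp add: mult_single plus_word_def)
next
  case (mult p a b)
  have "lin_ext g (Poly_Mapping.single s c * p * Poly_Mapping.single t d) = 0" for s t c d
  proof -
    have "lin_ext g (Poly_Mapping.single s c * q * Poly_Mapping.single t d)
        = c * d * lin_ext (\<lambda>w. g (s + w + t)) q" for q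
      by (induction q rule: free_alg_induct)
        (simp_all add: mult_single lin_ext_add distrib_left distrib_right)
    moreover have "lin_ext (\<lambda>w. g (s + w + t)) p = 0"
      by (rule mult.IH)
        (use mult.prems(1)[of "s + _" _ _ "_ + t"] mult.prems(2)[of "s + _" _ _ "_ + t"]
           mult.prems(3)[of "s + _" _ "_ + t"] in \<open>simp_all add: add.assoc\<close>)
    ultimately show ?thesis by simp
  qed
  then have "lin_ext g (Poly_Mapping.single s c * p * b) = 0" for s c
    by (induction b rule: free_alg_induct) (simp_all add: distrib_left lin_ext_add)
  then show ?case
    by (induction a rule: free_alg_induct) (simp_all add: distrib_right lin_ext_add)
qed (simp_all add: lin_ext_add)

lemma one_notin_ext_ideal: "1 \<notin> ext_ideal"
proof
  assume "1 \<in> (ext_ideal :: 'v::real_vector free_alg set)"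
  then have "lin_ext (\<lambda>w :: 'v word. if w = 0 then 1 else 0) 1 = 0"
    by (rule lin_ext_ideal) (auto simp: word_sum_eq_0_iff zero_word_def plus_word_def)
  then show False
    by (simp flip: single_one)
qed


subsection \<open>The quotient algebra\<close>

quotient_type (overloaded) 'v exterior =
  "'v::real_vector free_alg" / "\<lambda>p q. p - q \<in> ext_ideal"
proof (rule equivpI)
  show "reflp (\<lambda>p q :: 'v free_alg. p - q \<in> ext_ideal)"
    by (rule reflpI) (simp add: ext_ideal.zero)
  show "symp (\<lambda>p q :: 'v free_alg. p - q \<in> ext_ideal)"
    by (rule sympI) (metis ext_ideal_uminus minus_diff_eq)
  show "transp (\<lambda>p q :: 'v free_alg. p - q \<in> ext_ideal)"
  proof (rule transpI)
    fix p q r :: "'v free_alg"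
    assume "p - q \<in> ext_ideal" "q - r \<in> ext_ideal"
    then have "(p - q) + (q - r) \<in> ext_ideal" by (rule ext_ideal.sum)
    then show "p - r \<in> ext_ideal" by simp
  qed
qed

text \<open>The ring multiplication \<open>*\<close> on \<open>'v exterior\<close> is the wedge product.\<close>

instantiation exterior :: (real_vector) real_algebra_1
begin

lift_definition zero_exterior :: "'a exterior" is 0 .
lift_definition one_exterior :: "'a exterior" is 1 .

lift_definition plus_exterior :: "'a exterior \<Rightarrow> 'a exterior \<Rightarrow> 'a exterior" is "(+)"
proof -
  fix p p' q q' :: "'a free_alg"
  assume "p - p' \<in> ext_ideal" "q - q' \<in> ext_ideal"
  from ext_ideal.sum[OF this] show "p + q - (p' + q') \<in> ext_ideal"
    by (simp add: algebra_simps)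
qed

lift_definition uminus_exterior :: "'a exterior \<Rightarrow> 'a exterior" is uminus
proof -
  fix p p' :: "'a free_alg"
  assume "p - p' \<in> ext_ideal"
  from ext_ideal_uminus[OF this] show "- p - - p' \<in> ext_ideal" by simp
qed

lift_definition minus_exterior :: "'a exterior \<Rightarrow> 'a exterior \<Rightarrow> 'a exterior" is "(-)"
proof -
  fix p p' q q' :: "'a free_alg"
  assume "p - p' \<in> ext_ideal" "q - q' \<in> ext_ideal"
  from ext_ideal_diff[OF this] show "p - q - (p' - q') \<in> ext_ideal"
    by (simp add: algebra_simps)
qed

lift_definition times_exterior :: "'a exterior \<Rightarrow> 'a exterior \<Rightarrow> 'a exterior" is "(*)"
proof -
  fix p p' q q' :: "'a free_alg"
  assume "p - p' \<in> ext_ideal" "q - q' \<in> ext_ideal"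
  then have "(p - p') * q + p' * (q - q') \<in> ext_ideal"
    by (intro ext_ideal.sum ext_ideal_left ext_ideal_right)
  then show "p * q - p' * q' \<in> ext_ideal" by (simp add: algebra_simps)
qed

lift_definition scaleR_exterior :: "real \<Rightarrow> 'a exterior \<Rightarrow> 'a exterior" is "\<lambda>c p. scal c * p"
proof -
  fix c and p p' :: "'a free_alg"
  assume "p - p' \<in> ext_ideal"
  then have "scal c * (p - p') \<in> ext_ideal" by (rule ext_ideal_left)
  then show "scal c * p - scal c * p' \<in> ext_ideal" by (simp add: algebra_simps)
qed

instance
proof
  fix a b c :: "'a exterior" and r s :: real
  show "a + b + c = a + (b + c)"
    by transfer (simp add: add.assoc ext_ideal.zero)
  show "a + b = b + a"
    by transfer (simp add: add.commute ext_ideal.zero)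
  show "0 + a = a"
    by transfer (simp add: ext_ideal.zero)
  show "- a + a = 0"
    by transfer (simp add: ext_ideal.zero)
  show "a - b = a + - b"
    by transfer (simp add: ext_ideal.zero)
  show "a * b * c = a * (b * c)"
    by transfer (simp add: mult.assoc ext_ideal.zero)
  show "1 * a = a"
    by transfer (simp add: ext_ideal.zero)
  show "a * 1 = a"
    by transfer (simp add: ext_ideal.zero)
  show "(a + b) * c = a * c + b * c"
    by transfer (simp add: distrib_right ext_ideal.zero)
  show "a * (b + c) = a * b + a * c"
    by transfer (simp add: distrib_left ext_ideal.zero)
  show "(0 :: 'a exterior) \<noteq> 1"
    by transfer (use one_notin_ext_ideal ext_ideal_uminus in fastforce)
  show "r *\<^sub>R (a + b) = r *\<^sub>R a + r *\<^sub>R b"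
    by transfer (simp add: distrib_left ext_ideal.zero)
  show "(r + s) *\<^sub>R a = r *\<^sub>R a + s *\<^sub>R a"
    by transfer (simp add: single_add distrib_right ext_ideal.zero)
  show "r *\<^sub>R s *\<^sub>R a = (r * s) *\<^sub>R a"
    by transfer (simp add: mult.assoc[symmetric] mult_single ext_ideal.zero)
  show "1 *\<^sub>R a = a"
    by transfer (simp add: ext_ideal.zero)
  show "r *\<^sub>R a * b = r *\<^sub>R (a * b)"
    by transfer (simp add: mult.assoc ext_ideal.zero)
  show "a * r *\<^sub>R b = r *\<^sub>R (a * b)"
  proof transfer
    fix p q :: "'a free_alg" and r :: real
    have "p * (scal r * q) = scal r * (p * q)"
      by (metis mult.assoc scal_commute)
    then show "p * (scal r * q) - scal r * (p * q) \<in> ext_ideal"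
      by (simp add: ext_ideal.zero)
  qed
qed

end

lift_definition ext_of :: "'v::real_vector \<Rightarrow> 'v exterior" is letter .

definition wedge :: "'v::real_vector list \<Rightarrow> 'v exterior"
  where "wedge vs = prod_list (map ext_of vs)"

lemma linear_ext_of: "linear ext_of"
proof (rule linearI)
  fix v w :: 'a and c
  show "ext_of (v + w) = ext_of v + ext_of w"
    by transfer (metis diff_diff_eq ext_ideal.letter_add)
  show "ext_of (c *\<^sub>R v) = c *\<^sub>R ext_of v"
    by transfer (rule ext_ideal.letter_scale)
qed

lemma ext_of_square: "ext_of v * ext_of v = 0"
  by transfer (simp add: ext_ideal.square)

lemma wedge_eq_abs: "wedge vs = abs_exterior (Poly_Mapping.single (Word vs) 1)"
proof (induction vs)
  case Nil
  show ?case
    by (simp add: wedge_def one_exterior.abs_eq zero_word_def[symmetric])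
next
  case (Cons v vs)
  then show ?case
    by (simp add: wedge_def ext_of.abs_eq times_exterior.abs_eq mult_single plus_word_def)
qed


section \<open>The dual space and the pairing\<close>

typedef (overloaded) 'v dual = "{\<phi> :: 'v::real_vector \<Rightarrow> real. linear \<phi>}"
  morphisms dual_apply Abs_dual
  by (rule exI[of _ "\<lambda>_. 0"]) (simp add: linear_zero)

setup_lifting type_definition_dual

instantiation dual :: (real_vector) real_vector
begin

lift_definition zero_dual :: "'a dual" is "\<lambda>_. 0"
  by (rule linear_zero)
lift_definition plus_dual :: "'a dual \<Rightarrow> 'a dual \<Rightarrow> 'a dual" is "\<lambda>\<phi> \<psi> v. \<phi> v + \<psi> v"
  by (rule linear_compose_add)
lift_definition uminus_dual :: "'a dual \<Rightarrow> 'a dual" is "\<lambda>\<phi> v. - \<phi> v"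
  by (rule linear_compose_neg)
lift_definition minus_dual :: "'a dual \<Rightarrow> 'a dual \<Rightarrow> 'a dual" is "\<lambda>\<phi> \<psi> v. \<phi> v - \<psi> v"
  by (rule linear_compose_sub)
lift_definition scaleR_dual :: "real \<Rightarrow> 'a dual \<Rightarrow> 'a dual" is "\<lambda>c \<phi> v. c *\<^sub>R \<phi> v"
  by (rule linear_compose_scale_right)

instance
  by standard (transfer; simp add: fun_eq_iff algebra_simps)+

end

lemma linear_dual_apply: "linear (dual_apply \<phi>)"
  using dual_apply[of \<phi>] by simp

definition list_pairing :: "'v::real_vector list \<Rightarrow> 'v dual list \<Rightarrow> real"
  where "list_pairing vs ys =
    (if length vs = length ys
     then det (mat (length vs) (length vs) (\<lambda>(i, j). dual_apply (ys ! j) (vs ! i))) else 0)"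

definition word_pairing :: "'v::real_vector word \<Rightarrow> 'v dual word \<Rightarrow> real"
  where "word_pairing a b = list_pairing (letters a) (letters b)"

lemma det_row_combination:
  fixes M N L :: "real mat"
  assumes "M \<in> carrier_mat n n" "N \<in> carrier_mat n n" "L \<in> carrier_mat n n" "k < n"
    and "\<And>i j. i < n \<Longrightarrow> j < n \<Longrightarrow> i \<noteq> k \<Longrightarrow> M $$ (i, j) = L $$ (i, j) \<and> N $$ (i, j) = L $$ (i, j)"
    and "\<And>j. j < n \<Longrightarrow> L $$ (k, j) = c * M $$ (k, j) + d * N $$ (k, j)"
  shows "det L = c * det M + d * det N"
proof -
  have split: "(\<Prod>i = 0..<n. X $$ (i, p i)) = X $$ (k, p k) * (\<Prod>i\<in>{0..<n} - {k}. X $$ (i, p i))"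
    for X :: "real mat" and p
    by (rule prod.remove) (use assms(4) in auto)
  have "signof p * (\<Prod>i = 0..<n. L $$ (i, p i)) =
      c * (signof p * (\<Prod>i = 0..<n. M $$ (i, p i))) + d * (signof p * (\<Prod>i = 0..<n. N $$ (i, p i)))"
    if p: "p permutes {0..<n}" for p
  proof -
    have pn: "p i < n" if "i < n" for i
      using permutes_in_image[OF p, of i] that by simp
    have "(\<Prod>i\<in>{0..<n} - {k}. M $$ (i, p i)) = (\<Prod>i\<in>{0..<n} - {k}. L $$ (i, p i))"
      "(\<Prod>i\<in>{0..<n} - {k}. N $$ (i, p i)) = (\<Prod>i\<in>{0..<n} - {k}. L $$ (i, p i))"
      using assms(5) pn by (auto intro!: prod.cong)
    then show ?thesis
      unfolding split using assms(6)[OF pn[OF assms(4)]] by (simp add: algebra_simps)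
  qed
  then show ?thesis
    by (simp add: det_def'[OF assms(1)] det_def'[OF assms(2)] det_def'[OF assms(3)]
        sum_distrib_left flip: sum.distrib)
qed

lemma list_pairing_combination:
  "list_pairing (xs @ (c *\<^sub>R v + d *\<^sub>R w) # zs) ys =
    c * list_pairing (xs @ v # zs) ys + d * list_pairing (xs @ w # zs) ys"
proof (cases "length ys = Suc (length xs + length zs)")
  case True
  let ?M = "\<lambda>u. mat (length ys) (length ys) (\<lambda>(i, j). dual_apply (ys ! j) ((xs @ u # zs) ! i))"
  have "det (?M (c *\<^sub>R v + d *\<^sub>R w)) = c * det (?M v) + d * det (?M w)"
    by (rule det_row_combination[where k = "length xs" and n = "length ys"])
      (use True in \<open>auto simp: nth_append linear_add[OF linear_dual_apply] linear_scale[OF linear_dual_apply]\<close>)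
  then show ?thesis using True by (simp add: list_pairing_def)
qed (auto simp: list_pairing_def)

lemma list_pairing_repeat: "list_pairing (xs @ v # v # zs) ys = 0"
proof (cases "length ys = Suc (Suc (length xs + length zs))")
  case True
  let ?M = "mat (length ys) (length ys) (\<lambda>(i, j). dual_apply (ys ! j) ((xs @ v # v # zs) ! i))"
  have "det ?M = 0"
    by (rule det_identical_rows[of _ "length ys" "length xs" "Suc (length xs)"])
      (use True in \<open>auto simp: nth_append intro!: eq_vecI\<close>)
  then show ?thesis using True by (simp add: list_pairing_def)
qed (auto simp: list_pairing_def)

lemma list_pairing_transpose:
  "list_pairing vs ys =
    (if length vs = length ys
     then det (mat (length ys) (length ys) (\<lambda>(i, j). dual_apply (ys ! i) (vs ! j))) else 0)"
proof -
  have "transpose_mat (mat n n (\<lambda>(i, j). dual_apply (ys ! j) (vs ! i))) =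
      mat n n (\<lambda>(i, j). dual_apply (ys ! i) (vs ! j))" for n
    by (rule eq_matI) auto
  then show ?thesis
    unfolding list_pairing_def
    by (metis det_transpose mat_carrier)
qed

lemma list_pairing_combination_dual:
  "list_pairing vs (xs @ (c *\<^sub>R v + d *\<^sub>R w) # zs) =
    c * list_pairing vs (xs @ v # zs) + d * list_pairing vs (xs @ w # zs)"
proof (cases "length vs = Suc (length xs + length zs)")
  case True
  let ?M = "\<lambda>u. mat (length vs) (length vs) (\<lambda>(i, j). dual_apply ((xs @ u # zs) ! i) (vs ! j))"
  have "det (?M (c *\<^sub>R v + d *\<^sub>R w)) = c * det (?M v) + d * det (?M w)"
    by (rule det_row_combination[where k = "length xs" and n = "length vs"])
      (use True in \<open>auto simp: nth_append plus_dual.rep_eq scaleR_dual.rep_eq\<close>)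
  then show ?thesis using True by (simp add: list_pairing_transpose)
qed (auto simp: list_pairing_def)

lemma list_pairing_repeat_dual: "list_pairing vs (xs @ v # v # zs) = 0"
proof (cases "length vs = Suc (Suc (length xs + length zs))")
  case True
  let ?M = "mat (length vs) (length vs) (\<lambda>(i, j). dual_apply ((xs @ v # v # zs) ! i) (vs ! j))"
  have "det ?M = 0"
    by (rule det_identical_rows[of _ "length vs" "length xs" "Suc (length xs)"])
      (use True in \<open>auto simp: nth_append intro!: eq_vecI\<close>)
  then show ?thesis using True by (simp add: list_pairing_transpose)
qed (auto simp: list_pairing_def)

lemma lin_ext_word_pairing_left:
  assumes "p \<in> ext_ideal"
  shows "lin_ext (\<lambda>a. word_pairing a b) p = 0"
  using assms
proof (rule lin_ext_ideal)
  show "word_pairing (x + Word [v + w] + y) b =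
      word_pairing (x + Word [v] + y) b + word_pairing (x + Word [w] + y) b" for x y v w
    using list_pairing_combination[of _ 1 v 1 w] by (simp add: word_pairing_def)
  show "word_pairing (x + Word [c *\<^sub>R v] + y) b = c * word_pairing (x + Word [v] + y) b" for x y v c
    using list_pairing_combination[of _ c v 0 v] by (simp add: word_pairing_def)
  show "word_pairing (x + Word [v, v] + y) b = 0" for x y v
    by (simp add: word_pairing_def list_pairing_repeat)
qed

lemma lin_ext_word_pairing_right:
  assumes "q \<in> ext_ideal"
  shows "lin_ext (word_pairing a) q = 0"
  using assms
proof (rule lin_ext_ideal)
  show "word_pairing a (x + Word [v + w] + y) =
      word_pairing a (x + Word [v] + y) + word_pairing a (x + Word [w] + y)" for x y v w
    using list_pairing_combination_dual[of _ _ 1 v 1 w] by (simp add: word_pairing_def)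
  show "word_pairing a (x + Word [c *\<^sub>R v] + y) = c * word_pairing a (x + Word [v] + y)" for x y v c
    using list_pairing_combination_dual[of _ _ c v 0 v] by (simp add: word_pairing_def)
  show "word_pairing a (x + Word [v, v] + y) = 0" for x y v
    by (simp add: word_pairing_def list_pairing_repeat_dual)
qed

lemma lin_ext_swap:
  "lin_ext (\<lambda>a. lin_ext (g a) q) p = lin_ext (\<lambda>b. lin_ext (\<lambda>a. g a b) p) q"
  by (induction p rule: free_alg_induct)
    (simp_all add: lin_ext_add lin_ext_fun_add lin_ext_fun_scale)

text \<open>
  The duality between \<open>\<And>V\<close> and \<open>\<And>V\<^sup>*\<close>; it is characterised by being linear in
  both arguments together with \<open>pairing_wedge\<close>.
\<close>

lift_definition pairing :: "'v::real_vector exterior \<Rightarrow> 'v dual exterior \<Rightarrow> real"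
  is "\<lambda>p q. lin_ext (\<lambda>a. lin_ext (word_pairing a) q) p"
proof -
  fix p p' :: "'v free_alg" and q q' :: "'v dual free_alg"
  assume p: "p - p' \<in> ext_ideal" and q: "q - q' \<in> ext_ideal"
  have 1: "lin_ext (word_pairing a) q = lin_ext (word_pairing a) q'" for a
    using lin_ext_word_pairing_right[OF q] by (simp add: lin_ext_diff)
  have "lin_ext (\<lambda>a. word_pairing a b) p = lin_ext (\<lambda>a. word_pairing a b) p'" for b
    using lin_ext_word_pairing_left[OF p] by (simp add: lin_ext_diff)
  then show "lin_ext (\<lambda>a. lin_ext (word_pairing a) q) p =
      lin_ext (\<lambda>a. lin_ext (word_pairing a) q') p'"
    by (simp add: 1 lin_ext_swap[of word_pairing])
qed

lemma linear_pairing_left: "linear (\<lambda>x. pairing x u)"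
proof (rule linearI)
  fix x y :: "'a exterior" and c :: real
  show "pairing (x + y) u = pairing x u + pairing y u"
    by transfer (simp add: lin_ext_add)
  show "pairing (c *\<^sub>R x) u = c *\<^sub>R pairing x u"
    by transfer (simp add: lin_ext_scal_mult)
qed

lemma linear_pairing_right: "linear (pairing x)"
proof (rule linearI)
  fix u v :: "'a dual exterior" and c :: real
  show "pairing x (u + v) = pairing x u + pairing x v"
    by transfer (simp add: lin_ext_add lin_ext_fun_add)
  show "pairing x (c *\<^sub>R u) = c *\<^sub>R pairing x u"
    by transfer (simp add: lin_ext_scal_mult lin_ext_fun_scale)
qed

lemma pairing_wedge:
  "pairing (wedge vs) (wedge ys) =
    (if length vs = length ys
     then det (mat (length vs) (length vs) (\<lambda>(i, j). dual_apply (ys ! j) (vs ! i))) else 0)"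
  by (simp add: wedge_eq_abs pairing.abs_eq word_pairing_def list_pairing_def)

text \<open>
  The element described below exists and is unique because the pairing is perfect when \<open>V\<close> is
  finite-dimensional.
\<close>

definition interior :: "'v::real_vector exterior \<Rightarrow> 'v dual exterior \<Rightarrow> 'v exterior" (infixl "\<llcorner>" 70)
  where "v \<llcorner> y = (THE x. \<forall>u. pairing x u = pairing v (y * u))"

definition decomposable :: "nat \<Rightarrow> 'v::real_vector exterior \<Rightarrow> bool"
  where "decomposable r y \<longleftrightarrow>
    (if r = 0 then \<exists>c. y = of_real c else \<exists>ys. length ys = r \<and> y = wedge ys)"

definition self_annihilating :: "nat \<Rightarrow> 'v::real_vector exterior set \<Rightarrow> bool"
  where "self_annihilating t W \<longleftrightarrow>
    subspace W \<and>
    (\<forall>u\<in>W. \<forall>w\<in>W. \<forall>r<t. \<forall>y. decomposable r y \<longrightarrow> (u \<llcorner> y) * (w \<llcorner> y) = 0)"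


section \<open>Hypergraphs and monomials\<close>

definition hypergraph :: "nat \<Rightarrow> nat set set \<Rightarrow> bool"
  where "hypergraph n \<A> \<longleftrightarrow> \<A> \<subseteq> Pow {1..n}"

definition t_intersecting :: "nat \<Rightarrow> nat set set \<Rightarrow> bool"
  where "t_intersecting t \<A> \<longleftrightarrow> (\<forall>A\<in>\<A>. \<forall>B\<in>\<A>. t \<le> card (A \<inter> B))"

definition ordered_basis :: "nat \<Rightarrow> (nat \<Rightarrow> 'v::real_vector) \<Rightarrow> bool"
  where "ordered_basis n f \<longleftrightarrow>
    inj_on f {1..n} \<and> independent (f ` {1..n}) \<and> span (f ` {1..n}) = UNIV"

definition monomial :: "(nat \<Rightarrow> 'v::real_vector) \<Rightarrow> nat set \<Rightarrow> 'v exterior"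
  where "monomial f A = wedge (map f (sorted_list_of_set A))"

definition monomial_subspace :: "(nat \<Rightarrow> 'v::real_vector) \<Rightarrow> nat set set \<Rightarrow> 'v exterior set"
  where "monomial_subspace f \<A> = span (monomial f ` \<A>)"

definition subset_greater :: "nat set \<Rightarrow> nat set \<Rightarrow> bool"
  where "subset_greater A B \<longleftrightarrow>
    card A > card B \<or> (card A = card B \<and> A \<noteq> B \<and> Max (sym_diff A B) \<in> B)"

text \<open>The coefficient \<open>m\<^sub>A\<close> in \<open>w = (\<Sum>A \<subseteq> [n]. m\<^sub>A f\<^sub>A)\<close>.\<close>

definition coefficient :: "nat \<Rightarrow> (nat \<Rightarrow> 'v::real_vector) \<Rightarrow> 'v exterior \<Rightarrow> nat set \<Rightarrow> real"
  where "coefficient n f w A = representation (monomial f ` Pow {1..n}) w (monomial f A)"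

text \<open>The maximum of the support of \<open>w\<close> with respect to \<open>subset_greater\<close>.\<close>

definition initial_set :: "nat \<Rightarrow> (nat \<Rightarrow> 'v::real_vector) \<Rightarrow> 'v exterior \<Rightarrow> nat set"
  where "initial_set n f w =
    (THE A. A \<subseteq> {1..n} \<and> coefficient n f w A \<noteq> 0 \<and>
      (\<forall>B. B \<subseteq> {1..n} \<and> coefficient n f w B \<noteq> 0 \<and> B \<noteq> A \<longrightarrow> subset_greater A B))"

definition initial_hypergraph :: "nat \<Rightarrow> (nat \<Rightarrow> 'v::real_vector) \<Rightarrow> 'v exterior set \<Rightarrow> nat set set"
  where "initial_hypergraph n f W = {initial_set n f w | w. w \<in> W \<and> w \<noteq> 0}"

end

theory Submission
  imports Defs
begin

text \<open>
  Both parts rest on contraction by products of functionals.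

  Let \<open>A\<close> and \<open>B\<close> share at least \<open>t\<close> elements and let \<open>y\<close> be a product of fewer than \<open>t\<close>
  functionals. For dimension reasons some non-zero vector \<open>v\<close> in the span of the \<open>f\<^sub>c\<close> with
  \<open>c \<in> A \<inter> B\<close> is annihilated by all these functionals (\<open>common_kernel_vector\<close>). Both
  monomials are multiples of \<open>v\<close> (\<open>monomial_factor\<close>), and contraction by a functional is an
  antiderivation (\<open>interior_antiderivation\<close>), so contraction by \<open>y\<close> does not touch the factor \<open>v\<close>.
  Hence \<open>v\<close> divides both contractions and their product vanishes. Part (1) follows, because the
  condition is bilinear in the two elements of the subspace.

  For part (2), let \<open>u\<close> and \<open>w\<close> have initial sets \<open>A\<close> and \<open>B\<close>, and suppose that
  \<open>C = A \<inter> B\<close> has fewer than \<open>t\<close> elements. Contract \<open>u\<close> and \<open>w\<close> by the dual monomial of \<open>C\<close>.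
  A pair of terms \<open>f\<^bsub>A'\<^esub>\<close> of \<open>u\<close> and \<open>f\<^bsub>B'\<^esub>\<close> of \<open>w\<close> contributes to the monomial indexed by
  \<open>(A \<union> B) - C\<close> in the product only if \<open>A' \<inter> B' = C\<close> and \<open>A' \<union> B' = A \<union> B\<close>
  (\<open>coord_contracted_product_nonzero_iff\<close>). The order on subsets allows no such exchange of elements
  that makes both sets smaller (\<open>subset_greater_exchange\<close>), so \<open>(A', B') = (A, B)\<close> is the only
  contributing pair and the coefficient is \<open>\<plusminus>\<close> the product of the two leading coefficients. The product
  of the contractions is therefore non-zero, which is impossible in a \<open>t\<close>-self-annihilating subspace.
\<close>

(* Keeps the index set in the form {1..n} during simplification. *)
declare One_nat_def [simp del]

section \<open>Identities in the exterior algebra\<close>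

lemma exterior_induct [case_names wedge add scale]:
  fixes x :: "'v::real_vector exterior"
  assumes "\<And>vs. P (wedge vs)" "\<And>x y. P x \<Longrightarrow> P y \<Longrightarrow> P (x + y)" "\<And>c x. P x \<Longrightarrow> P (c *\<^sub>R x)"
  shows "P x"
proof (induction x rule: exterior.abs_induct)
  fix p :: "'v free_alg"
  show "P (abs_exterior p)"
  proof (induction p rule: free_alg_induct)
    case (single a c)
    have "abs_exterior (Poly_Mapping.single a c) = c *\<^sub>R wedge (letters a)"
      by (simp add: wedge_eq_abs scaleR_exterior.abs_eq mult_single)
    with assms show ?case by simp
  next
    case (add p q)
    then show ?case using assms(2) by (simp flip: plus_exterior.abs_eq)
  qed
qed

lemma ext_of_anticommute: "ext_of v * ext_of w = - (ext_of w * ext_of v)"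
proof -
  have "ext_of (v + w) * ext_of (v + w) = 0" by (rule ext_of_square)
  then have "ext_of v * ext_of w + ext_of w * ext_of v = 0"
    by (simp add: linear_add[OF linear_ext_of] distrib_left distrib_right ext_of_square add.commute)
  then show ?thesis by (simp add: eq_neg_iff_add_eq_0)
qed

lemma ext_of_left_anticommute: "ext_of v * (ext_of w * x) = - (ext_of w * (ext_of v * x))"
  using arg_cong[OF ext_of_anticommute[of v w], of "\<lambda>z. z * x"] by (simp add: mult.assoc)

lemma ext_of_left_square: "ext_of v * (ext_of v * x) = 0"
  by (simp add: ext_of_square flip: mult.assoc)

text \<open>
  The second copy of \<open>v\<close> moves past the letters of \<open>x\<close> up to sign, until it meets the first one.
  Thus two elements with a common left factor \<open>v\<close> have product zero.
\<close>

lemma ext_of_sandwich: "ext_of v * (x * (ext_of v * y)) = 0"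
proof (induction x rule: exterior_induct)
  case (wedge vs)
  show ?case
  proof (induction vs)
    case Nil
    show ?case by (simp add: wedge_def ext_of_left_square)
  next
    case (Cons w vs)
    have "ext_of v * (wedge (w # vs) * (ext_of v * y))
        = - (ext_of w * (ext_of v * (wedge vs * (ext_of v * y))))"
      using ext_of_left_anticommute[of v w "wedge vs * (ext_of v * y)"] by (simp add: wedge_def mult.assoc)
    with Cons show ?case by simp
  qed
qed (simp_all add: distrib_left distrib_right)

section \<open>Multiplication of monomials\<close>

lemma monomial_empty [simp]: "monomial f {} = 1"
  by (simp add: monomial_def wedge_def)

lemma ext_of_mult_wedge_insort:
  fixes xs :: "nat list"
  assumes "sorted xs" "i \<notin> set xs"
  shows "ext_of (f i) * wedge (map f xs)
    = (-1) ^ length (filter (\<lambda>a. a < i) xs) *\<^sub>R wedge (map f (insort i xs))"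
  using assms
proof (induction xs)
  case Nil
  show ?case by (simp add: wedge_def)
next
  case (Cons x xs)
  show ?case
  proof (cases "i < x")
    case True
    then have "filter (\<lambda>a. a < i) (x # xs) = []"
      using Cons.prems by (fastforce simp: filter_empty_conv)
    moreover have "insort i (x # xs) = i # x # xs" using True by (simp add: less_imp_le)
    ultimately show ?thesis by (simp only: list.map) (simp add: wedge_def)
  next
    case False
    then have "x < i" using Cons.prems by simp
    moreover have "ext_of (f i) * wedge (map f (x # xs))
        = - (ext_of (f x) * (ext_of (f i) * wedge (map f xs)))"
      using ext_of_left_anticommute[of "f i"] by (simp add: wedge_def)
    ultimately show ?thesis using Cons by (simp add: wedge_def)
  qed
qed

text \<open>
  The sign for moving \<open>f\<^sub>i\<close> past the smaller elements of \<open>A\<close>. It depends on the index sets alone, so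
  the same sign occurs for a basis and for its dual basis, and the two cancel in the pairing.
\<close>

definition insertion_sign :: "nat \<Rightarrow> nat set \<Rightarrow> real"
  where "insertion_sign i A = (-1) ^ card {a \<in> A. a < i}"

lemma insertion_sign_square [simp]: "insertion_sign i A * insertion_sign i A = 1"
  by (simp add: insertion_sign_def flip: power_add mult_2)

lemma ext_of_mult_monomial_notin:
  assumes "finite A" "i \<notin> A"
  shows "ext_of (f i) * monomial f A = insertion_sign i A *\<^sub>R monomial f (insert i A)"
proof -
  have "length (filter (\<lambda>a. a < i) (sorted_list_of_set A)) = card {a \<in> A. a < i}"
    using assms by (subst distinct_length_filter) (auto intro!: arg_cong[where f = card])
  then show ?thesis
    using assms ext_of_mult_wedge_insort[of "sorted_list_of_set A" i f]
    by (simp add: monomial_def insertion_sign_def)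
qed

lemma monomial_insert:
  assumes "finite A" "i \<notin> A"
  shows "monomial f (insert i A) = insertion_sign i A *\<^sub>R (ext_of (f i) * monomial f A)"
  using assms by (simp add: ext_of_mult_monomial_notin)

lemma monomial_remove:
  assumes "finite A" "i \<in> A"
  shows "monomial f A = insertion_sign i (A - {i}) *\<^sub>R (ext_of (f i) * monomial f (A - {i}))"
  using monomial_insert[of "A - {i}" i f] assms by (simp add: insert_absorb)

lemma ext_of_mult_monomial_in:
  assumes "finite A" "i \<in> A"
  shows "ext_of (f i) * monomial f A = 0"
  by (subst monomial_remove[OF assms]) (simp add: ext_of_left_square)

lemma monomial_mult_disjoint:
  assumes "finite A" "finite B" "A \<inter> B = {}"
  obtains s where "s \<noteq> 0" "monomial f A * monomial f B = s *\<^sub>R monomial f (A \<union> B)"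
proof -
  have "\<exists>s. s \<noteq> 0 \<and> monomial f A * monomial f B = s *\<^sub>R monomial f (A \<union> B)"
    using assms(1,3)
  proof (induction A rule: finite_induct)
    case empty
    show ?case by (auto intro!: exI[of _ 1])
  next
    case (insert a A)
    then obtain s where s: "s \<noteq> 0" "monomial f A * monomial f B = s *\<^sub>R monomial f (A \<union> B)"
      by auto
    have "monomial f (insert a A) * monomial f B
        = insertion_sign a A *\<^sub>R (ext_of (f a) * (monomial f A * monomial f B))"
      using insert(1,2) by (simp add: monomial_insert mult.assoc)
    also have "\<dots> = (insertion_sign a A * s) *\<^sub>R (ext_of (f a) * monomial f (A \<union> B))"
      by (simp add: s(2))
    also have "ext_of (f a) * monomial f (A \<union> B)
        = insertion_sign a (A \<union> B) *\<^sub>R monomial f (insert a A \<union> B)"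
      using insert(1,2,4) assms(2) by (simp add: ext_of_mult_monomial_notin)
    finally have "monomial f (insert a A) * monomial f B
        = (insertion_sign a A * s * insertion_sign a (A \<union> B)) *\<^sub>R monomial f (insert a A \<union> B)"
      by simp
    moreover have "insertion_sign a A * s * insertion_sign a (A \<union> B) \<noteq> 0"
      using s(1) by (simp add: insertion_sign_def)
    ultimately show ?case by metis
  qed
  with that show thesis by blast
qed

lemma monomial_mult_meet:
  assumes "finite A" "finite B" "A \<inter> B \<noteq> {}"
  shows "monomial f A * monomial f B = 0"
proof -
  from assms(3) obtain i where "i \<in> A" "i \<in> B" by blast
  with assms show ?thesis
    using ext_of_sandwich[of "f i" "monomial f (A - {i})" "monomial f (B - {i})"]
    by (subst (1 2) monomial_remove[where i = i]) (simp_all add: mult.assoc)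
qed

text \<open>
  The span of the monomials contains \<open>1\<close> and is closed under left multiplication by vectors, so it
  contains every wedge product. The family need only span, so the lemma serves \<open>V\<close> as well as \<open>V\<^sup>*\<close>.
\<close>

lemma span_monomials:
  assumes "span (f ` {1..n}) = UNIV"
  shows "span (monomial f ` Pow {1..n}) = UNIV"
proof -
  let ?S = "span (monomial f ` Pow {1..n})"
  have letter: "ext_of (f i) * x \<in> ?S" if "i \<in> {1..n}" "x \<in> ?S" for i x
    using that(2)
  proof (induction rule: span_induct_alt)
    case base
    show ?case by (simp add: span_zero)
  next
    case (step c x y)
    then obtain A where A: "x = monomial f A" "A \<subseteq> {1..n}" by auto
    then have "finite A" using finite_subset by blast
    moreover have "monomial f (insert i A) \<in> ?S" using A that(1) by (intro span_base) blast
    ultimately have "ext_of (f i) * x \<in> ?S"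
      using A by (cases "i \<in> A")
        (simp_all add: ext_of_mult_monomial_in ext_of_mult_monomial_notin span_zero span_scale)
    with step show ?case by (simp add: distrib_left span_add span_scale)
  qed
  have vector: "ext_of v * x \<in> ?S" if "x \<in> ?S" for v x
  proof -
    have "v \<in> span (f ` {1..n})" by (simp add: assms)
    then show ?thesis
      by (induction rule: span_induct_alt)
        (auto simp: linear_0[OF linear_ext_of] linear_add[OF linear_ext_of] linear_scale[OF linear_ext_of]
          span_zero distrib_right intro!: span_add span_scale letter that)
  qed
  have "wedge vs \<in> ?S" for vs
  proof (induction vs)
    case Nil
    have "monomial f {} \<in> ?S" by (intro span_base imageI) simp
    then show ?case by (simp add: wedge_def)
  next
    case (Cons v vs)
    then show ?case using vector by (simp add: wedge_def)
  qed
  then have "x \<in> ?S" for x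
    by (induction x rule: exterior_induct) (simp_all add: span_add span_scale)
  then show ?thesis by blast
qed

text \<open>
  A vector \<open>v\<close> in the span of the \<open>f\<^sub>c\<close> with \<open>c \<in> C \<subseteq> A\<close> can replace a factor \<open>f\<^sub>a\<close> that occurs in \<open>v\<close>:
  in the product of \<open>v\<close> with the monomial of \<open>A - {a}\<close> every other term of \<open>v\<close> repeats a letter.
\<close>

lemma monomial_factor:
  assumes "finite A" "C \<subseteq> A" "\<exists>a\<in>C. k a \<noteq> 0"
  obtains p where "monomial f A = ext_of (\<Sum>c\<in>C. k c *\<^sub>R f c) * p"
proof -
  from assms(3) obtain a where a: "a \<in> C" "k a \<noteq> 0" by blast
  have fin: "finite C" using assms finite_subset by blast
  let ?p = "monomial f (A - {a})" and ?s = "insertion_sign a (A - {a})"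
  have a_term: "ext_of (f a) * ?p = ?s *\<^sub>R monomial f A"
    using assms a monomial_remove[of A a f] by auto
  have "ext_of (\<Sum>c\<in>C. k c *\<^sub>R f c) * ?p = (\<Sum>c\<in>C. k c *\<^sub>R (ext_of (f c) * ?p))"
    by (simp add: linear_sum[OF linear_ext_of] linear_scale[OF linear_ext_of] sum_distrib_right)
  also have "\<dots> = (\<Sum>c\<in>C. if c = a then (k a * ?s) *\<^sub>R monomial f A else 0)"
    using assms by (intro sum.cong) (auto simp: ext_of_mult_monomial_in a_term)
  also have "\<dots> = (k a * ?s) *\<^sub>R monomial f A" using a fin by simp
  finally have "monomial f A = ext_of (\<Sum>c\<in>C. k c *\<^sub>R f c) * ((1 / (k a * ?s)) *\<^sub>R ?p)"
    using a by (simp add: insertion_sign_def)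
  with that show thesis by blast
qed

section \<open>Common kernels of functionals\<close>

text \<open>
  A homogeneous linear system with fewer equations than unknowns has a non-trivial solution; the
  proof eliminates one unknown for each equation.
\<close>

lemma common_kernel_vector:
  fixes g :: "nat \<Rightarrow> 'v::real_vector"
  assumes "finite C" "length ys < card C"
  shows "\<exists>k. (\<exists>c\<in>C. k c \<noteq> 0) \<and> (\<forall>\<phi>\<in>set ys. dual_apply \<phi> (\<Sum>c\<in>C. k c *\<^sub>R g c) = 0)"
  using assms
proof (induction ys arbitrary: C g)
  case Nil
  then show ?case by (intro exI[of _ "\<lambda>_. 1"]) (auto simp: card_gt_0_iff)
next
  case (Cons \<phi> ys)
  note lin = linear_sum[OF linear_dual_apply] linear_scale[OF linear_dual_apply]
    linear_diff[OF linear_dual_apply]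
  show ?case
  proof (cases "\<forall>c\<in>C. dual_apply \<phi> (g c) = 0")
    case True
    with Cons.IH[of C g] Cons.prems show ?thesis by (auto simp: lin)
  next
    case False
    then obtain d where d: "d \<in> C" "dual_apply \<phi> (g d) \<noteq> 0" by blast
    define q where "q c = dual_apply \<phi> (g c) / dual_apply \<phi> (g d)" for c
    have "length ys < card (C - {d})" using Cons.prems d by simp
    with Cons.IH[of "C - {d}" "\<lambda>c. g c - q c *\<^sub>R g d"] Cons.prems obtain k where
      k: "\<exists>c\<in>C - {d}. k c \<noteq> 0"
        "\<forall>\<psi>\<in>set ys. dual_apply \<psi> (\<Sum>c\<in>C - {d}. k c *\<^sub>R (g c - q c *\<^sub>R g d)) = 0" by auto
    \<comment> \<open>The pivot coefficient is forced by the correction terms \<open>q c *\<^sub>R g d\<close>.\<close>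
    define k' where "k' = k(d := - (\<Sum>c\<in>C - {d}. k c * q c))"
    have "(\<Sum>c\<in>C. k' c *\<^sub>R g c) = k' d *\<^sub>R g d + (\<Sum>c\<in>C - {d}. k' c *\<^sub>R g c)"
      using Cons.prems d by (simp add: sum.remove)
    also have "(\<Sum>c\<in>C - {d}. k' c *\<^sub>R g c) = (\<Sum>c\<in>C - {d}. k c *\<^sub>R g c)"
      by (intro sum.cong) (auto simp: k'_def)
    also have "k' d *\<^sub>R g d + \<dots> = (\<Sum>c\<in>C - {d}. k c *\<^sub>R (g c - q c *\<^sub>R g d))"
      by (simp add: k'_def scaleR_diff_right sum_subtractf scaleR_sum_left)
    finally have eq: "(\<Sum>c\<in>C. k' c *\<^sub>R g c) = (\<Sum>c\<in>C - {d}. k c *\<^sub>R (g c - q c *\<^sub>R g d))" .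
    have "dual_apply \<phi> (\<Sum>c\<in>C - {d}. k c *\<^sub>R (g c - q c *\<^sub>R g d)) = 0"
      using d by (simp add: lin q_def)
    with k eq show ?thesis
      by (intro exI[of _ k']) (auto simp: k'_def)
  qed
qed

section \<open>The order on subsets\<close>

lemma Max_sym_diff_in:
  assumes "finite A" "finite B" "A \<noteq> B"
  shows "Max (sym_diff A B) \<in> sym_diff A B"
  using assms by (intro Max_in) auto

lemma subset_greater_asym:
  assumes "finite A" "finite B" "subset_greater A B" "subset_greater B A"
  shows False
proof -
  have "A \<noteq> B" "Max (sym_diff A B) \<in> B" "Max (sym_diff B A) \<in> A"
    using assms(3,4) by (auto simp: subset_greater_def)
  moreover have "Max (sym_diff B A) = Max (sym_diff A B)" by (simp only: Un_commute)
  ultimately show False using Max_sym_diff_in[OF assms(1,2)] by auto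
qed

text \<open>
  Reading subsets as binary numbers, the largest element in which two sets differ decides which number
  is larger. Among sets of equal size \<open>subset_greater\<close> is therefore the reversed order of natural
  numbers, and its maximum is the set with the least number.
\<close>

lemma sum_power2_less:
  fixes A B :: "nat set"
  assumes "finite A" "finite B" "A \<noteq> B" "Max (sym_diff A B) \<in> B"
  shows "(\<Sum>a\<in>A. 2 ^ a) < (\<Sum>b\<in>B. 2 ^ b :: nat)"
proof -
  let ?m = "Max (sym_diff A B)"
  have m: "?m \<in> B - A" using assms Max_sym_diff_in[of A B] by blast
  have "A - B \<subseteq> {..<?m}"
  proof
    fix a assume a: "a \<in> A - B"
    then have "a \<le> ?m" using assms by (intro Max_ge) auto
    with a m show "a \<in> {..<?m}" by (cases "a = ?m") auto
  qed
  then have "(\<Sum>a\<in>A - B. 2 ^ a) \<le> (\<Sum>a<?m. 2 ^ a :: nat)"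
    by (intro sum_mono2) auto
  also have "\<dots> < 2 ^ ?m" by (simp add: lessThan_atLeast0 sum_power2)
  also have "\<dots> \<le> (\<Sum>b\<in>B - A. 2 ^ b)"
    using m assms by (intro member_le_sum) auto
  finally show ?thesis
    using assms sum.Int_Diff[of A "power (2 :: nat)" B] sum.Int_Diff[of B "power (2 :: nat)" A]
    by (simp add: Int_commute)
qed

lemma subset_greater_maximum:
  assumes "finite S" "S \<noteq> {}" "\<And>A. A \<in> S \<Longrightarrow> finite A"
  shows "\<exists>A\<in>S. \<forall>B\<in>S. B \<noteq> A \<longrightarrow> subset_greater A B"
proof -
  define T where "T = {A \<in> S. card A = Max (card ` S)}"
  let ?code = "\<lambda>A. \<Sum>a\<in>A. 2 ^ a :: nat"
  have "Max (card ` S) \<in> card ` S" using assms by (intro Max_in) auto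
  then have "T \<noteq> {}" by (auto simp: T_def)
  then obtain A where A: "A \<in> T" "\<And>B. B \<in> T \<Longrightarrow> ?code A \<le> ?code B"
    using ex_has_least_nat[of "\<lambda>A. A \<in> T" _ ?code] by blast
  have "subset_greater A B" if B: "B \<in> S" "B \<noteq> A" for B
  proof (cases "B \<in> T")
    case True
    have fin: "finite A" "finite B" using A True assms by (auto simp: T_def)
    have "Max (sym_diff A B) \<notin> A"
    proof
      assume "Max (sym_diff A B) \<in> A"
      then have "Max (sym_diff B A) \<in> A" by (simp only: Un_commute)
      with fin B have "?code B < ?code A" by (intro sum_power2_less)
      with A(2)[OF True] show False by simp
    qed
    then have "Max (sym_diff A B) \<in> B" using Max_sym_diff_in[of A B] fin B by blast
    with A True B show ?thesis by (auto simp: subset_greater_def T_def)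
  next
    case False
    with B have "card B \<noteq> Max (card ` S)" by (simp add: T_def)
    moreover have "card B \<le> Max (card ` S)" using assms B by (intro Max_ge) auto
    ultimately show ?thesis using A by (simp add: subset_greater_def T_def)
  qed
  with A show ?thesis by (auto simp: T_def)
qed

text \<open>
  Passing from \<open>(A, B)\<close> to \<open>(A', B')\<close> exchanges elements between the two sets, so \<open>A\<close> and \<open>A'\<close> differ
  in the same elements as \<open>B\<close> and \<open>B'\<close>. If both sets became smaller in the order, then the sizes would
  agree and the largest exchanged element would lie in \<open>A'\<close> and in \<open>B'\<close>, hence in
  \<open>A' \<inter> B' = A \<inter> B\<close>, although it is not a common element of \<open>A\<close> and \<open>A'\<close>.
\<close>

lemma subset_greater_exchange:
  assumes fin: "finite A" "finite B" "finite A'" "finite B'"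
    and eq: "A \<inter> B = A' \<inter> B'" "A \<union> B = A' \<union> B'"
    and le: "A' = A \<or> subset_greater A A'" "B' = B \<or> subset_greater B B'"
  shows "A' = A \<and> B' = B"
proof (rule ccontr)
  assume "\<not> ?thesis"
  with eq have ne: "A' \<noteq> A" "B' \<noteq> B" by blast+
  have "card A + card B = card A' + card B'"
    using card_Un_Int[OF fin(1,2)] card_Un_Int[OF fin(3,4)] eq by simp
  then have max: "Max (sym_diff A A') \<in> A'" "Max (sym_diff B B') \<in> B'"
    using ne le by (auto simp: subset_greater_def)
  have "sym_diff A A' = sym_diff B B'" using eq by blast
  then have "Max (sym_diff A A') = Max (sym_diff B B')" by (rule arg_cong)
  with max eq have "Max (sym_diff A A') \<in> A \<inter> A'" by auto
  moreover have "Max (sym_diff A A') \<in> sym_diff A A'"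
    using fin ne by (intro Max_sym_diff_in) auto
  ultimately show False by blast
qed

section \<open>Dual bases and the interior product\<close>

locale exterior_basis =
  fixes n :: nat and f :: "nat \<Rightarrow> 'v::real_vector"
  assumes basis: "ordered_basis n f"
begin

lemma inj_f: "inj_on f {1..n}" and indep_f: "independent (f ` {1..n})"
  and span_f: "span (f ` {1..n}) = UNIV"
  using basis by (simp_all add: ordered_basis_def)

lemma finite_index_set: "A \<subseteq> {1..n} \<Longrightarrow> finite A"
  by (erule finite_subset) simp

text \<open>
  The basis of \<open>V\<^sup>*\<close> dual to \<open>f\<close>.
\<close>

definition fd :: "nat \<Rightarrow> 'v dual"
  where "fd i = Abs_dual (\<lambda>v. representation (f ` {1..n}) v (f i))"

lemma dual_apply_fd: "dual_apply (fd i) v = representation (f ` {1..n}) v (f i)"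
proof -
  have "linear (\<lambda>v. representation (f ` {1..n}) v (f i))"
    by (rule linearI) (simp_all add: representation_add representation_scale indep_f span_f)
  then show ?thesis by (simp add: fd_def Abs_dual_inverse)
qed

lemma fd_f: "i \<in> {1..n} \<Longrightarrow> j \<in> {1..n} \<Longrightarrow> dual_apply (fd j) (f i) = (if i = j then 1 else 0)"
  by (simp add: dual_apply_fd representation_basis[OF indep_f] inj_on_eq_iff[OF inj_f])

lemma span_fd: "span (fd ` {1..n}) = UNIV"
proof -
  have "\<phi> \<in> span (fd ` {1..n})" for \<phi>
  proof -
    let ?\<psi> = "\<Sum>i\<in>{1..n}. dual_apply \<phi> (f i) *\<^sub>R fd i"
    have sum_apply: "dual_apply (sum g A) v = (\<Sum>i\<in>A. dual_apply (g i) v)" for g :: "nat \<Rightarrow> 'v dual" and A v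
      by (induction A rule: infinite_finite_induct) (simp_all add: zero_dual.rep_eq plus_dual.rep_eq)
    have "dual_apply \<phi> v = dual_apply ?\<psi> v" for v
    proof (rule linear_eq_on[OF linear_dual_apply linear_dual_apply])
      show "v \<in> span (f ` {1..n})" by (simp add: span_f)
      show "dual_apply \<phi> b = dual_apply ?\<psi> b" if "b \<in> f ` {1..n}" for b
        using that by (auto simp: sum_apply scaleR_dual.rep_eq fd_f if_distrib cong: if_cong)
    qed
    then have "dual_apply \<phi> = dual_apply ?\<psi>" by (rule ext)
    then have "\<phi> = ?\<psi>" by (simp only: dual_apply_inject)
    moreover have "?\<psi> \<in> span (fd ` {1..n})" by (intro span_sum span_scale span_base imageI)
    ultimately show ?thesis by (rule ssubst)
  qed
  then show ?thesis by blast
qed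

text \<open>
  For equal index sets the determinant is that of the identity matrix; for different index sets of the
  same size an element of \<open>A - B\<close> gives a zero row.
\<close>

lemma pairing_monomial:
  assumes "A \<subseteq> {1..n}" "B \<subseteq> {1..n}"
  shows "pairing (monomial f A) (monomial fd B) = (if A = B then 1 else 0)"
proof -
  have fin: "finite A" "finite B" using assms finite_index_set by simp_all
  let ?a = "sorted_list_of_set A" and ?b = "sorted_list_of_set B"
  let ?M = "mat (card A) (card A) (\<lambda>(i, j). dual_apply (fd (?b ! j)) (f (?a ! i)))"
  have nth: "?a ! i \<in> A" if "i < card A" for i
    using fin nth_mem[of i ?a] that by simp
  have nth': "?b ! i \<in> B" if "i < card B" for i
    using fin nth_mem[of i ?b] that by simp
  have pair: "pairing (monomial f A) (monomial fd B) = (if card A = card B then det ?M else 0)"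
    by (auto simp: monomial_def pairing_wedge fin intro!: arg_cong[where f = det] cong_mat)
  show ?thesis
  proof (cases "A = B")
    case True
    have "?M = 1\<^sub>m (card A)"
    proof (rule eq_matI)
      fix i j assume ij: "i < dim_row (1\<^sub>m (card A))" "j < dim_col (1\<^sub>m (card A))"
      then have "i < card A" "j < card A" by auto
      then have "?a ! i \<in> {1..n}" "?a ! j \<in> {1..n}" using nth assms by blast+
      moreover have "?a ! i = ?a ! j \<longleftrightarrow> i = j"
        using ij fin by (simp add: nth_eq_iff_index_eq)
      ultimately show "?M $$ (i, j) = 1\<^sub>m (card A) $$ (i, j)"
        using ij True by (simp add: fd_f)
    qed auto
    then show ?thesis using pair True by simp
  next
    case False
    have "det ?M = 0" if "card A = card B"
    proof -
      have "\<not> A \<subseteq> B" using False that fin card_subset_eq by blast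
      then obtain a where a: "a \<in> A" "a \<notin> B" by blast
      then obtain k where k: "k < card A" "?a ! k = a"
        using fin by (metis in_set_conv_nth length_sorted_list_of_set set_sorted_list_of_set)
      have zero: "?M $$ (k, j) = 0" if "j < card A" for j
        using that k a nth'[of j] \<open>card A = card B\<close> assms by (auto simp: fd_f subset_iff)
      \<comment> \<open>A zero row is the trivial linear combination of any two rows.\<close>
      have "det ?M = 0 * det ?M + 0 * det ?M"
        by (rule det_row_combination[where k = k]) (use k zero in auto)
      then show ?thesis by simp
    qed
    then show ?thesis using pair False by simp
  qed
qed

abbreviation coord :: "nat set \<Rightarrow> 'v exterior \<Rightarrow> real"
  where "coord A x \<equiv> pairing x (monomial fd A)"

lemma monomial_expansion: "x = (\<Sum>A\<in>Pow {1..n}. coord A x *\<^sub>R monomial f A)"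
proof (rule linear_eq_on[where f = "\<lambda>x. x"])
  show "x \<in> span (monomial f ` Pow {1..n})" by (simp add: span_monomials[OF span_f])
  show "linear (\<lambda>x. x)" by (simp add: linear_iff)
  show "linear (\<lambda>x. \<Sum>A\<in>Pow {1..n}. coord A x *\<^sub>R monomial f A)"
    by (rule linearI)
      (simp_all add: linear_add[OF linear_pairing_left] linear_scale[OF linear_pairing_left]
        scaleR_add_left sum.distrib scaleR_sum_right)
  fix b assume "b \<in> monomial f ` Pow {1..n}"
  then obtain B where B: "b = monomial f B" "B \<in> Pow {1..n}" by blast
  have "(\<Sum>A\<in>Pow {1..n}. coord A b *\<^sub>R monomial f A)
      = (\<Sum>A\<in>Pow {1..n}. if A = B then monomial f A else 0)"
    by (rule sum.cong) (use B in \<open>auto simp: pairing_monomial\<close>)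
  also have "\<dots> = b" using B by simp
  finally show "b = (\<Sum>A\<in>Pow {1..n}. coord A b *\<^sub>R monomial f A)" ..
qed

lemma exterior_eqI:
  assumes "\<And>A. A \<subseteq> {1..n} \<Longrightarrow> coord A x = coord A y"
  shows "x = y"
  by (subst (1 2) monomial_expansion) (use assms in \<open>auto intro!: sum.cong\<close>)

text \<open>
  The dual monomials span \<open>\<And>V\<^sup>*\<close>, so the defining equation of the interior product has to be checked on
  them only.
\<close>

lemma pairing_eqI:
  fixes v :: "'v exterior"
  assumes "\<And>A. A \<subseteq> {1..n} \<Longrightarrow> coord A x = pairing v (y * monomial fd A)"
  shows "pairing x u = pairing v (y * u)"
proof (rule linear_eq_on[where f = "pairing x"])
  show "u \<in> span (monomial fd ` Pow {1..n})" by (simp add: span_monomials[OF span_fd])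
  show "linear (\<lambda>u. pairing v (y * u))"
    by (rule linearI) (simp_all add: linear_add[OF linear_pairing_right]
        linear_scale[OF linear_pairing_right] distrib_left)
qed (use assms linear_pairing_right in auto)

text \<open>
  The pairing is perfect because of the dual bases: prescribing the pairings with the dual monomials
  gives an element with the defining property, and only one. So the description by \<open>THE\<close> is meaningful.
\<close>

lemma pairing_interior:
  fixes v :: "'v exterior"
  shows "pairing (v \<llcorner> y) u = pairing v (y * u)"
proof -
  let ?x = "\<Sum>A\<in>Pow {1..n}. pairing v (y * monomial fd A) *\<^sub>R monomial f A"
  have "coord B ?x = pairing v (y * monomial fd B)" if "B \<subseteq> {1..n}" for B
  proof -
    have "coord B ?x = (\<Sum>A\<in>Pow {1..n}. if A = B then pairing v (y * monomial fd A) else 0)"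
      unfolding linear_sum[OF linear_pairing_left]
      by (rule sum.cong) (use that in \<open>auto simp: linear_scale[OF linear_pairing_left] pairing_monomial\<close>)
    then show ?thesis using that by simp
  qed
  then have x: "\<forall>u. pairing ?x u = pairing v (y * u)" using pairing_eqI by blast
  have "z = ?x" if "\<forall>u. pairing z u = pairing v (y * u)" for z
    by (rule exterior_eqI) (simp only: that x)
  with x have "\<forall>u. pairing (v \<llcorner> y) u = pairing v (y * u)"
    unfolding interior_def by (rule theI)
  then show ?thesis by blast
qed

lemma interior_eqI:
  fixes v :: "'v exterior"
  assumes "\<And>A. A \<subseteq> {1..n} \<Longrightarrow> coord A x = pairing v (y * monomial fd A)"
  shows "v \<llcorner> y = x"
  by (rule exterior_eqI) (simp add: pairing_interior assms)

lemma interior_add_left: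
  fixes x :: "'v exterior"
  shows "(x + y) \<llcorner> u = x \<llcorner> u + y \<llcorner> u"
  by (rule interior_eqI) (simp add: linear_add[OF linear_pairing_left] pairing_interior)

lemma interior_scale_left:
  fixes x :: "'v exterior"
  shows "(c *\<^sub>R x) \<llcorner> u = c *\<^sub>R (x \<llcorner> u)"
  by (rule interior_eqI) (simp add: linear_scale[OF linear_pairing_left] pairing_interior)

lemma linear_interior_left: "linear (\<lambda>x :: 'v exterior. x \<llcorner> u)"
  by (rule linearI) (simp_all add: interior_add_left interior_scale_left)

lemma linear_interior_right:
  fixes x :: "'v exterior"
  shows "linear (\<lambda>u. x \<llcorner> u)"
  by (rule linearI; rule interior_eqI)
    (simp_all add: linear_add[OF linear_pairing_left] linear_scale[OF linear_pairing_left]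
      pairing_interior distrib_right linear_add[OF linear_pairing_right]
      linear_scale[OF linear_pairing_right])

lemma interior_mult:
  fixes x :: "'v exterior"
  shows "x \<llcorner> (y * z) = x \<llcorner> y \<llcorner> z"
  by (rule interior_eqI) (simp add: pairing_interior mult.assoc)

lemma interior_one:
  fixes x :: "'v exterior"
  shows "x \<llcorner> 1 = x"
  by (rule interior_eqI) simp

lemma interior_of_real:
  fixes x :: "'v exterior"
  shows "x \<llcorner> of_real c = c *\<^sub>R x"
  by (simp add: of_real_def linear_scale[OF linear_interior_right] interior_one)

lemma interior_fd_monomial_notin:
  assumes "A \<subseteq> {1..n}" "j \<in> {1..n}" "j \<notin> A"
  shows "monomial f A \<llcorner> ext_of (fd j) = 0"
proof (rule interior_eqI)
  fix B assume B: "B \<subseteq> {1..n}"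
  then have "finite B" by (rule finite_index_set)
  moreover have "A \<noteq> insert j B" using assms by blast
  ultimately show "coord B 0 = pairing (monomial f A) (ext_of (fd j) * monomial fd B)"
    using assms B
    by (cases "j \<in> B") (simp_all add: ext_of_mult_monomial_in ext_of_mult_monomial_notin
        linear_0[OF linear_pairing_left] linear_0[OF linear_pairing_right]
        linear_scale[OF linear_pairing_right] pairing_monomial)
qed

text \<open>
  Adding \<open>j\<close> to \<open>A\<close> in \<open>\<And>V\<close> and to \<open>B\<close> in \<open>\<And>V\<^sup>*\<close> costs the same sign when \<open>A = B\<close>, so the signs cancel.
\<close>

lemma interior_fd_mult_monomial:
  assumes "A \<subseteq> {1..n}" "j \<in> {1..n}" "j \<notin> A"
  shows "(ext_of (f j) * monomial f A) \<llcorner> ext_of (fd j) = monomial f A"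
proof (rule interior_eqI)
  fix B assume B: "B \<subseteq> {1..n}"
  have fin: "finite A" "finite B" using assms B finite_index_set by simp_all
  show "coord B (monomial f A)
      = pairing (ext_of (f j) * monomial f A) (ext_of (fd j) * monomial fd B)"
  proof (cases "j \<in> B")
    case True
    then show ?thesis using assms B fin
      by (auto simp: ext_of_mult_monomial_in linear_0[OF linear_pairing_right] pairing_monomial)
  next
    case False
    then have "insert j A = insert j B \<longleftrightarrow> A = B" using assms by (simp add: insert_ident)
    with False show ?thesis using assms B fin
      by (simp add: ext_of_mult_monomial_notin linear_scale[OF linear_pairing_right]
          linear_scale[OF linear_pairing_left] pairing_monomial)
  qed
qed

text \<open>
  Only the position of the index \<open>j\<close> matters. If \<open>j \<notin> A\<close>, the contraction of \<open>f\<^sub>A\<close> vanishes. If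
  \<open>j \<in> A\<close>, write \<open>f\<^sub>A\<close> as a multiple of \<open>f\<^sub>j\<close> and move \<open>f\<^sub>j\<close> to the front of the product, where
  contraction cancels it.
\<close>

lemma interior_antiderivation_monomial:
  assumes i: "i \<in> {1..n}" and j: "j \<in> {1..n}" and A: "A \<subseteq> {1..n}"
  shows "(ext_of (f i) * monomial f A) \<llcorner> ext_of (fd j)
    = dual_apply (fd j) (f i) *\<^sub>R monomial f A - ext_of (f i) * (monomial f A \<llcorner> ext_of (fd j))"
proof -
  note lin0 = linear_0[OF linear_interior_left] and scale = linear_scale[OF linear_interior_left]
  \<comment> \<open>Multiplication by \<open>f\<^sub>i\<close> with \<open>i \<noteq> j\<close> keeps a monomial free of \<open>f\<^sub>j\<close>; the scalar \<open>c\<close> is 0 if \<open>i\<close> already occurs.\<close>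
  have avoid: "\<exists>c B. B \<subseteq> {1..n} \<and> j \<notin> B \<and> ext_of (f i) * monomial f A' = c *\<^sub>R monomial f B"
    if "A' \<subseteq> {1..n}" "j \<notin> A'" "i \<noteq> j" for A'
  proof (cases "i \<in> A'")
    case True
    then show ?thesis using that finite_index_set[OF that(1)]
      by (intro exI[of _ 0] exI[of _ "{}"]) (auto simp: ext_of_mult_monomial_in)
  next
    case False
    then show ?thesis using that i finite_index_set[OF that(1)]
      by (intro exI[of _ "insertion_sign i A'"] exI[of _ "insert i A'"])
        (auto simp: ext_of_mult_monomial_notin)
  qed
  show ?thesis
  proof (cases "j \<in> A")
    case False
    show ?thesis
    proof (cases "i = j")
      case True
      then show ?thesis
        using assms False by (simp add: interior_fd_mult_monomial interior_fd_monomial_notin fd_f)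
    next
      case i_j: False
      from avoid[OF A False this] obtain c B where
        "B \<subseteq> {1..n}" "j \<notin> B" "ext_of (f i) * monomial f A = c *\<^sub>R monomial f B" by blast
      then show ?thesis
        using assms False i_j by (simp add: interior_fd_monomial_notin fd_f scale)
    qed
  next
    case True
    let ?A = "A - {j}" let ?s = "insertion_sign j ?A"
    have A': "?A \<subseteq> {1..n}" "j \<notin> ?A" using A by auto
    have split: "monomial f A = ?s *\<^sub>R (ext_of (f j) * monomial f ?A)"
      using True finite_index_set[OF A] by (intro monomial_remove) auto
    have contract: "monomial f A \<llcorner> ext_of (fd j) = ?s *\<^sub>R monomial f ?A"
      by (simp only: split scale interior_fd_mult_monomial[OF A'(1) j A'(2)])
    show ?thesis
    proof (cases "i = j")
      case True
      have "ext_of (f j) * monomial f A = 0"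
        unfolding split by (simp add: ext_of_left_square)
      moreover have "ext_of (f j) * (monomial f A \<llcorner> ext_of (fd j)) = monomial f A"
        by (simp only: contract mult_scaleR_right split[symmetric])
      ultimately show ?thesis
        using True j by (simp add: lin0 fd_f)
    next
      case i_j: False
      from avoid[OF A' this] obtain c B where B:
        "B \<subseteq> {1..n}" "j \<notin> B" "ext_of (f i) * monomial f ?A = c *\<^sub>R monomial f B" by blast
      have "ext_of (f i) * monomial f A = - ?s *\<^sub>R (ext_of (f j) * (ext_of (f i) * monomial f ?A))"
        unfolding split using ext_of_left_anticommute[of "f i" "f j"] by simp
      then have "(ext_of (f i) * monomial f A) \<llcorner> ext_of (fd j)
          = - ?s *\<^sub>R (ext_of (f i) * monomial f ?A)"
        using B j by (simp add: scale interior_fd_mult_monomial linear_neg[OF linear_interior_left])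
      then show ?thesis using i j i_j by (simp add: contract fd_f)
    qed
  qed
qed

text \<open>
  Both sides are linear in \<open>x\<close>, \<open>v\<close> and \<open>\<phi>\<close>, so the rule extends from basis elements, one argument
  at a time.
\<close>

lemma interior_antiderivation:
  fixes x :: "'v exterior"
  shows "(ext_of v * x) \<llcorner> ext_of \<phi> = dual_apply \<phi> v *\<^sub>R x - ext_of v * (x \<llcorner> ext_of \<phi>)"
proof -
  note lin = linear_add[OF linear_interior_left] linear_scale[OF linear_interior_left]
    linear_add[OF linear_interior_right] linear_scale[OF linear_interior_right]
    linear_add[OF linear_dual_apply] linear_scale[OF linear_dual_apply]
    linear_add[OF linear_ext_of] linear_scale[OF linear_ext_of]
    plus_dual.rep_eq scaleR_dual.rep_eq
  have 1: "(ext_of (f i) * x) \<llcorner> ext_of (fd j)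
      = dual_apply (fd j) (f i) *\<^sub>R x - ext_of (f i) * (x \<llcorner> ext_of (fd j))"
    if "i \<in> {1..n}" "j \<in> {1..n}" for i j x
  proof (rule linear_eq_on[where x = x])
    show "x \<in> span (monomial f ` Pow {1..n})" by (simp add: span_monomials[OF span_f])
    show "linear (\<lambda>x. (ext_of (f i) * x) \<llcorner> ext_of (fd j))"
      by (rule linearI) (simp_all add: lin distrib_left)
    show "linear (\<lambda>x. dual_apply (fd j) (f i) *\<^sub>R x - ext_of (f i) * (x \<llcorner> ext_of (fd j)))"
      by (rule linearI) (simp_all add: lin algebra_simps)
  qed (use that interior_antiderivation_monomial in auto)
  have 2: "(ext_of v * x) \<llcorner> ext_of (fd j)
      = dual_apply (fd j) v *\<^sub>R x - ext_of v * (x \<llcorner> ext_of (fd j))"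
    if "j \<in> {1..n}" for j v x
  proof (rule linear_eq_on[where x = v])
    show "v \<in> span (f ` {1..n})" by (simp add: span_f)
    show "linear (\<lambda>v. (ext_of v * x) \<llcorner> ext_of (fd j))"
      by (rule linearI) (simp_all add: lin distrib_right)
    show "linear (\<lambda>v. dual_apply (fd j) v *\<^sub>R x - ext_of v * (x \<llcorner> ext_of (fd j)))"
      by (rule linearI) (simp_all add: lin algebra_simps)
  qed (use that 1 in auto)
  show ?thesis
  proof (rule linear_eq_on[where x = \<phi>])
    show "\<phi> \<in> span (fd ` {1..n})" by (simp add: span_fd)
    show "linear (\<lambda>\<phi>. (ext_of v * x) \<llcorner> ext_of \<phi>)"
      by (rule linearI) (simp_all add: lin)
    show "linear (\<lambda>\<phi>. dual_apply \<phi> v *\<^sub>R x - ext_of v * (x \<llcorner> ext_of \<phi>))"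
      by (rule linearI) (simp_all add: lin algebra_simps)
  qed (use 2 in auto)
qed

section \<open>Contraction of a common factor\<close>

lemma interior_wedge_annihilating:
  fixes x :: "'v exterior"
  assumes "\<And>\<phi>. \<phi> \<in> set ys \<Longrightarrow> dual_apply \<phi> v = 0"
  shows "(ext_of v * x) \<llcorner> wedge ys = (-1) ^ length ys *\<^sub>R (ext_of v * (x \<llcorner> wedge ys))"
  using assms
proof (induction ys arbitrary: x)
  case Nil
  show ?case by (simp add: wedge_def interior_one)
next
  case (Cons y ys)
  have "(ext_of v * x) \<llcorner> wedge (y # ys) = (- (ext_of v * (x \<llcorner> ext_of y))) \<llcorner> wedge ys"
    using Cons.prems by (simp add: wedge_def interior_mult interior_antiderivation)
  also have "\<dots> = - ((-1) ^ length ys *\<^sub>R (ext_of v * (x \<llcorner> ext_of y \<llcorner> wedge ys)))"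
    using Cons by (simp add: linear_neg[OF linear_interior_left])
  finally show ?case by (simp add: wedge_def interior_mult)
qed

text \<open>
  Contraction by a short product of functionals passes, up to a scalar, through multiplication by a
  suitable non-trivial combination of the \<open>f\<^sub>c\<close> with \<open>c \<in> C\<close>. In degree \<open>0\<close> contraction is multiplication
  by a scalar and any combination will do.
\<close>

lemma interior_decomposable_annihilating:
  fixes y :: "'v dual exterior"
  assumes "decomposable r y" "r < card C" "finite C"
  obtains k s where "\<exists>a\<in>C. k a \<noteq> 0"
    "\<And>x. (ext_of (\<Sum>c\<in>C. k c *\<^sub>R f c) * x) \<llcorner> y = s *\<^sub>R (ext_of (\<Sum>c\<in>C. k c *\<^sub>R f c) * (x \<llcorner> y))"
proof (cases "r = 0")
  case True
  then obtain c where "y = of_real c" using assms(1) by (auto simp: decomposable_def)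
  moreover have "\<exists>a\<in>C. (\<lambda>_. 1 :: real) a \<noteq> 0" using assms by (cases "C = {}") auto
  ultimately show ?thesis
    using that[of "\<lambda>_. 1" 1] by (simp add: interior_of_real)
next
  case False
  then obtain ys where ys: "length ys = r" "y = wedge ys" using assms(1) by (auto simp: decomposable_def)
  with assms common_kernel_vector[of C ys f] obtain k where k: "\<exists>a\<in>C. k a \<noteq> 0"
    "\<forall>\<phi>\<in>set ys. dual_apply \<phi> (\<Sum>c\<in>C. k c *\<^sub>R f c) = 0" by blast
  with ys show ?thesis
    by (intro that[of k "(-1) ^ r"]) (simp_all add: interior_wedge_annihilating)
qed

text \<open>
  The vector annihilated by \<open>y\<close> is chosen in the span of the common letters, so it divides both
  monomials, and it still divides both contractions.
\<close>

lemma contracted_monomials_mult_0: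
  fixes y :: "'v dual exterior"
  assumes "decomposable r y" "r < card (A \<inter> B)" "finite A" "finite B"
  shows "(monomial f A \<llcorner> y) * (monomial f B \<llcorner> y) = 0"
proof -
  obtain k s where k: "\<exists>a\<in>A \<inter> B. k a \<noteq> 0"
    and s: "\<And>x. (ext_of (\<Sum>c\<in>A \<inter> B. k c *\<^sub>R f c) * x) \<llcorner> y
      = s *\<^sub>R (ext_of (\<Sum>c\<in>A \<inter> B. k c *\<^sub>R f c) * (x \<llcorner> y))"
    using interior_decomposable_annihilating[OF assms(1,2)] assms by blast
  obtain p where "monomial f A = ext_of (\<Sum>c\<in>A \<inter> B. k c *\<^sub>R f c) * p"
    using monomial_factor[OF _ _ k, of A f] assms by blast
  moreover obtain q where "monomial f B = ext_of (\<Sum>c\<in>A \<inter> B. k c *\<^sub>R f c) * q"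
    using monomial_factor[OF _ _ k, of B f] assms by blast
  ultimately show ?thesis by (simp add: s mult.assoc ext_of_sandwich)
qed

theorem self_annihilating_monomial_subspace:
  assumes "hypergraph n \<A>" "t_intersecting t \<A>"
  shows "self_annihilating t (monomial_subspace f \<A>)"
  unfolding self_annihilating_def monomial_subspace_def
proof (intro conjI ballI allI impI)
  show "subspace (span (monomial f ` \<A>))" by simp
  fix u w r and y :: "'v dual exterior"
  assume u: "u \<in> span (monomial f ` \<A>)" and w: "w \<in> span (monomial f ` \<A>)"
    and r: "r < t" and y: "decomposable r y"
  note lin = linear_0[OF linear_interior_left] linear_add[OF linear_interior_left]
    linear_scale[OF linear_interior_left] distrib_left distrib_right
  have "(monomial f A \<llcorner> y) * (w \<llcorner> y) = 0" if A: "A \<in> \<A>" for A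
    using w
  proof (induction rule: span_induct_alt)
    case (step c x z)
    then obtain B where B: "x = monomial f B" "B \<in> \<A>" by blast
    with A assms r have "r < card (A \<inter> B)" "finite A" "finite B"
      by (auto simp: t_intersecting_def hypergraph_def intro: less_le_trans finite_subset)
    with B y step show ?case by (simp add: lin contracted_monomials_mult_0)
  qed (simp add: lin)
  with u show "(u \<llcorner> y) * (w \<llcorner> y) = 0"
    by (induction rule: span_induct_alt) (auto simp: lin)
qed

section \<open>Initial sets\<close>

lemma inj_monomial: "inj_on (monomial f) (Pow {1..n})"
proof (rule inj_onI)
  fix A B assume "A \<in> Pow {1..n}" "B \<in> Pow {1..n}" "monomial f A = monomial f B"
  then show "A = B" using pairing_monomial[of A B] pairing_monomial[of B B] by (auto split: if_splits)
qed

lemma independent_monomials: "independent (monomial f ` Pow {1..n})"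
proof (rule independent_if_scalars_zero)
  fix c x assume sum: "(\<Sum>x\<in>monomial f ` Pow {1..n}. c x *\<^sub>R x) = 0"
    and "x \<in> monomial f ` Pow {1..n}"
  then obtain B where B: "x = monomial f B" "B \<in> Pow {1..n}" by blast
  have "0 = coord B (\<Sum>A\<in>Pow {1..n}. c (monomial f A) *\<^sub>R monomial f A)"
    using sum by (simp add: sum.reindex[OF inj_monomial] linear_0[OF linear_pairing_left])
  also have "\<dots> = (\<Sum>A\<in>Pow {1..n}. if A = B then c (monomial f A) else 0)"
    unfolding linear_sum[OF linear_pairing_left]
    by (rule sum.cong) (use B in \<open>auto simp: linear_scale[OF linear_pairing_left] pairing_monomial\<close>)
  finally show "c x = 0" using B by simp
qed simp

lemma coefficient_eq_coord:
  assumes "A \<subseteq> {1..n}"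
  shows "coefficient n f w A = coord A w"
proof (rule linear_eq_on[where x = w and g = "coord A"])
  note repr = independent_monomials span_monomials[OF span_f]
  show "linear (\<lambda>w. coefficient n f w A)"
    by (rule linearI) (simp_all add: coefficient_def representation_add representation_scale repr)
  show "linear (coord A)" by (rule linear_pairing_left)
  show "w \<in> span (monomial f ` Pow {1..n})" by (simp add: repr)
  show "coefficient n f b A = coord A b" if "b \<in> monomial f ` Pow {1..n}" for b
  proof -
    from that obtain B where B: "b = monomial f B" "B \<in> Pow {1..n}" by blast
    then have "monomial f B = monomial f A \<longleftrightarrow> B = A"
      using inj_monomial assms by (auto simp: inj_on_def)
    then show ?thesis
      using B assms by (auto simp: coefficient_def representation_basis repr pairing_monomial)
  qed
qed

text \<open>
  The support of a non-zero element is finite and non-empty, so it has a maximum, which is unique because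
  the order is asymmetric; this makes the description of the initial set by \<open>THE\<close> meaningful.
\<close>

lemma initial_set:
  assumes "w \<noteq> 0"
  shows "initial_set n f w \<subseteq> {1..n}" "coord (initial_set n f w) w \<noteq> 0"
    "\<And>B. B \<subseteq> {1..n} \<Longrightarrow> coord B w \<noteq> 0 \<Longrightarrow> B = initial_set n f w \<or> subset_greater (initial_set n f w) B"
proof -
  let ?S = "{A. A \<subseteq> {1..n} \<and> coord A w \<noteq> 0}"
  have "?S \<noteq> {}"
  proof
    assume "?S = {}"
    then have "w = 0" by (intro exterior_eqI) (auto simp: linear_0[OF linear_pairing_left])
    with assms show False by simp
  qed
  moreover have "finite ?S" by (rule finite_subset[of _ "Pow {1..n}"]) auto
  ultimately have "\<exists>A\<in>?S. \<forall>B\<in>?S. B \<noteq> A \<longrightarrow> subset_greater A B"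
    by (intro subset_greater_maximum) (simp_all add: finite_index_set)
  then obtain A where A: "A \<in> ?S" "\<forall>B\<in>?S. B \<noteq> A \<longrightarrow> subset_greater A B" by (rule bexE)
  have "\<exists>!A. A \<subseteq> {1..n} \<and> coefficient n f w A \<noteq> 0 \<and>
      (\<forall>B. B \<subseteq> {1..n} \<and> coefficient n f w B \<noteq> 0 \<and> B \<noteq> A \<longrightarrow> subset_greater A B)"
  proof (rule ex1I[of _ A])
    fix B assume B: "B \<subseteq> {1..n} \<and> coefficient n f w B \<noteq> 0 \<and>
      (\<forall>B'. B' \<subseteq> {1..n} \<and> coefficient n f w B' \<noteq> 0 \<and> B' \<noteq> B \<longrightarrow> subset_greater B B')"
    show "B = A"
    proof (rule ccontr)
      assume "B \<noteq> A"
      moreover have "coord B w \<noteq> 0" "coefficient n f w A \<noteq> 0"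
        using A B coefficient_eq_coord[of _ w] by auto
      ultimately have gt: "subset_greater A B" "subset_greater B A" using A B by auto
      show False using subset_greater_asym[OF _ _ gt] finite_index_set A B by simp
    qed
  qed (use A in \<open>auto simp: coefficient_eq_coord\<close>)
  then have *: "initial_set n f w \<subseteq> {1..n} \<and> coefficient n f w (initial_set n f w) \<noteq> 0 \<and>
      (\<forall>B. B \<subseteq> {1..n} \<and> coefficient n f w B \<noteq> 0 \<and> B \<noteq> initial_set n f w
        \<longrightarrow> subset_greater (initial_set n f w) B)"
    unfolding initial_set_def by (rule theI')
  then show "initial_set n f w \<subseteq> {1..n}" "coord (initial_set n f w) w \<noteq> 0"
    "\<And>B. B \<subseteq> {1..n} \<Longrightarrow> coord B w \<noteq> 0 \<Longrightarrow> B = initial_set n f w \<or> subset_greater (initial_set n f w) B"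
    by (auto simp: coefficient_eq_coord)
qed

lemma interior_monomials_subset:
  assumes "A \<subseteq> {1..n}" "C \<subseteq> A"
  obtains s where "s \<noteq> 0" "monomial f A \<llcorner> monomial fd C = s *\<^sub>R monomial f (A - C)"
proof -
  have C: "C \<subseteq> {1..n}" and AC: "A - C \<subseteq> {1..n}" using assms by blast+
  have "finite C" "finite (A - C)" using C AC by (simp_all only: finite_index_set)
  then obtain s where "s \<noteq> 0"
    "monomial fd C * monomial fd (A - C) = s *\<^sub>R monomial fd (C \<union> (A - C))"
    by (rule monomial_mult_disjoint[OF _ _ Diff_disjoint, where f = fd])
  moreover have "C \<union> (A - C) = A" using assms by blast
  ultimately have s: "s \<noteq> 0" "monomial fd C * monomial fd (A - C) = s *\<^sub>R monomial fd A"
    by simp_all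
  have "monomial f A \<llcorner> monomial fd C = s *\<^sub>R monomial f (A - C)"
  proof (rule interior_eqI)
    fix B assume B: "B \<subseteq> {1..n}"
    have fin: "finite B" "finite C" using B C by (simp_all only: finite_index_set)
    show "coord B (s *\<^sub>R monomial f (A - C)) = pairing (monomial f A) (monomial fd C * monomial fd B)"
    proof (cases "B = A - C")
      case True
      have "pairing (monomial f A) (monomial fd C * monomial fd B) = s"
        unfolding True s(2) using assms(1)
        by (simp add: linear_scale[OF linear_pairing_right] pairing_monomial)
      moreover have "coord B (monomial f (A - C)) = 1"
        unfolding True using AC by (simp add: pairing_monomial)
      ultimately show ?thesis by (simp add: linear_scale[OF linear_pairing_left])
    next
      case False
      have "pairing (monomial f A) (monomial fd C * monomial fd B) = 0"
      proof (cases "C \<inter> B = {}")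
        case True
        then obtain s' where "monomial fd C * monomial fd B = s' *\<^sub>R monomial fd (C \<union> B)"
          using monomial_mult_disjoint[OF fin(2,1) True, of fd] by blast
        moreover have "A \<noteq> C \<union> B" using True False by blast
        ultimately show ?thesis using assms B C
          by (simp add: linear_scale[OF linear_pairing_right] pairing_monomial)
      qed (simp add: monomial_mult_meet fin linear_0[OF linear_pairing_right])
      moreover have "coord B (monomial f (A - C)) = 0"
        using False AC B by (auto simp: pairing_monomial)
      ultimately show ?thesis by (simp add: linear_scale[OF linear_pairing_left])
    qed
  qed
  then show thesis by (rule that[OF s(1)])
qed

lemma interior_monomials_not_subset:
  assumes "A \<subseteq> {1..n}" "C \<subseteq> {1..n}" "\<not> C \<subseteq> A"
  shows "monomial f A \<llcorner> monomial fd C = 0"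
proof (rule interior_eqI)
  fix B assume B: "B \<subseteq> {1..n}"
  have fin: "finite B" "finite C" using B assms(2) by (simp_all only: finite_index_set)
  have "pairing (monomial f A) (monomial fd C * monomial fd B) = 0"
  proof (cases "C \<inter> B = {}")
    case True
    then obtain s where "monomial fd C * monomial fd B = s *\<^sub>R monomial fd (C \<union> B)"
      using monomial_mult_disjoint[OF fin(2,1) True, of fd] by blast
    moreover have "A \<noteq> C \<union> B" using assms(3) by auto
    ultimately show ?thesis using assms B
      by (simp add: linear_scale[OF linear_pairing_right] pairing_monomial)
  qed (simp add: monomial_mult_meet fin linear_0[OF linear_pairing_right])
  then show "coord B 0 = pairing (monomial f A) (monomial fd C * monomial fd B)"
    by (simp add: linear_0[OF linear_pairing_left])
qed

text \<open>
  Contraction by the dual monomial of \<open>C\<close> removes \<open>C\<close> from an index set, or gives zero if \<open>C\<close> is not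
  contained in it; the product of two monomials is the monomial of the union, up to sign, or zero if the
  index sets meet.
\<close>

lemma coord_contracted_product_nonzero_iff:
  assumes "A \<subseteq> {1..n}" "B \<subseteq> {1..n}" "C \<subseteq> {1..n}" "D \<subseteq> {1..n}"
  shows "coord D ((monomial f A \<llcorner> monomial fd C) * (monomial f B \<llcorner> monomial fd C)) \<noteq> 0
    \<longleftrightarrow> C \<subseteq> A \<and> C \<subseteq> B \<and> A \<inter> B \<subseteq> C \<and> (A \<union> B) - C = D"
proof (cases "C \<subseteq> A \<and> C \<subseteq> B")
  case False
  then have "\<not> C \<subseteq> A \<or> \<not> C \<subseteq> B" by blast
  then have "monomial f A \<llcorner> monomial fd C = 0 \<or> monomial f B \<llcorner> monomial fd C = 0"
    using interior_monomials_not_subset[OF assms(1,3)] interior_monomials_not_subset[OF assms(2,3)] by metis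
  then have "(monomial f A \<llcorner> monomial fd C) * (monomial f B \<llcorner> monomial fd C) = 0" by auto
  moreover note False
  ultimately show ?thesis using linear_0[OF linear_pairing_left] by auto
next
  case True
  obtain s where s: "s \<noteq> 0" "monomial f A \<llcorner> monomial fd C = s *\<^sub>R monomial f (A - C)"
    using interior_monomials_subset[OF assms(1)] True by metis
  obtain s' where s': "s' \<noteq> 0" "monomial f B \<llcorner> monomial fd C = s' *\<^sub>R monomial f (B - C)"
    using interior_monomials_subset[OF assms(2)] True by metis
  have fin: "finite (A - C)" "finite (B - C)" using assms(1,2) by (simp_all add: finite_index_set)
  show ?thesis
  proof (cases "A \<inter> B \<subseteq> C")
    case False
    then have "monomial f (A - C) * monomial f (B - C) = 0"
      using fin by (intro monomial_mult_meet) auto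
    with False show ?thesis by (simp add: s s' linear_0[OF linear_pairing_left])
  next
    case AB: True
    then have disj: "(A - C) \<inter> (B - C) = {}" by blast
    obtain s'' where s'': "s'' \<noteq> 0"
      "monomial f (A - C) * monomial f (B - C) = s'' *\<^sub>R monomial f (A - C \<union> (B - C))"
      using monomial_mult_disjoint[OF fin disj, of f] by blast
    have "A - C \<union> (B - C) = A \<union> B - C" by blast
    then have "coord D ((monomial f A \<llcorner> monomial fd C) * (monomial f B \<llcorner> monomial fd C))
        = s * s' * s'' * coord D (monomial f (A \<union> B - C))"
      by (simp add: s s' s'' linear_scale[OF linear_pairing_left])
    moreover have "coord D (monomial f (A \<union> B - C)) = (if A \<union> B - C = D then 1 else 0)"
      using assms by (intro pairing_monomial) auto
    ultimately show ?thesis using s s' s'' True AB by simp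
  qed
qed

lemma decomposable_dual_monomial:
  assumes "finite C"
  shows "decomposable (card C) (monomial fd C)"
proof (cases "card C = 0")
  case True
  with assms show ?thesis by (auto simp: decomposable_def intro!: exI[of _ 1])
next
  case False
  then show ?thesis
    by (auto simp: decomposable_def monomial_def intro!: exI[of _ "map fd (sorted_list_of_set C)"])
qed

lemma contracted_product_nonzero:
  assumes "u \<noteq> 0" "w \<noteq> 0"
  defines "C \<equiv> initial_set n f u \<inter> initial_set n f w"
  shows "(u \<llcorner> monomial fd C) * (w \<llcorner> monomial fd C) \<noteq> 0"
proof
  assume zero: "(u \<llcorner> monomial fd C) * (w \<llcorner> monomial fd C) = 0"
  let ?A = "initial_set n f u" and ?B = "initial_set n f w"
  let ?P = "Pow {1..n}" and ?D = "?A \<union> ?B - C"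
  let ?T = "\<lambda>A B. coord ?D ((monomial f A \<llcorner> monomial fd C) * (monomial f B \<llcorner> monomial fd C))"
  have AB: "?A \<subseteq> {1..n}" "?B \<subseteq> {1..n}" using initial_set assms by blast+
  then have CD: "C \<subseteq> {1..n}" "?D \<subseteq> {1..n}" by (auto simp: C_def)
  \<comment> \<open>All pairs of terms other than the pair of leading terms drop out of the coefficient at \<open>?D\<close>.\<close>
  have only: "coord A u * coord B w * ?T A B = (if A = ?A \<and> B = ?B then coord ?A u * coord ?B w * ?T ?A ?B else 0)"
    if "A \<in> ?P" "B \<in> ?P" for A B
  proof (rule ccontr)
    assume neg: "\<not> ?thesis"
    then have ne: "coord A u \<noteq> 0" "coord B w \<noteq> 0" "?T A B \<noteq> 0" "\<not> (A = ?A \<and> B = ?B)"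
      by (auto split: if_splits)
    with that CD have "C \<subseteq> A \<and> C \<subseteq> B \<and> A \<inter> B \<subseteq> C \<and> A \<union> B - C = ?D"
      using coord_contracted_product_nonzero_iff[of A B C ?D] by simp
    then have "?A \<inter> ?B = A \<inter> B" "?A \<union> ?B = A \<union> B" by (auto simp: C_def)
    moreover have "A = ?A \<or> subset_greater ?A A" "B = ?B \<or> subset_greater ?B B"
      using initial_set(3) assms that ne by auto
    moreover have "finite A" "finite B" "finite ?A" "finite ?B"
      using that AB by (simp_all add: finite_index_set)
    ultimately have "A = ?A \<and> B = ?B" using subset_greater_exchange by blast
    with ne show False by blast
  qed
  have expand: "u \<llcorner> monomial fd C = (\<Sum>A\<in>?P. coord A u *\<^sub>R (monomial f A \<llcorner> monomial fd C))" for u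
    by (subst monomial_expansion[of u])
      (simp add: linear_sum[OF linear_interior_left] linear_scale[OF linear_interior_left])
  have "0 = coord ?D ((u \<llcorner> monomial fd C) * (w \<llcorner> monomial fd C))"
    by (simp add: zero linear_0[OF linear_pairing_left])
  also have "\<dots> = (\<Sum>A\<in>?P. \<Sum>B\<in>?P. coord A u * coord B w * ?T A B)"
    unfolding expand[of u] expand[of w]
    by (simp add: sum_product linear_sum[OF linear_pairing_left] linear_scale[OF linear_pairing_left]
        mult.assoc mult.left_commute)
  also have "\<dots> = (\<Sum>A\<in>?P. \<Sum>B\<in>?P. if A = ?A \<and> B = ?B then coord ?A u * coord ?B w * ?T ?A ?B else 0)"
    by (intro sum.cong refl only)
  also have "\<dots> = (\<Sum>A\<in>?P. if A = ?A then coord ?A u * coord ?B w * ?T ?A ?B else 0)"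
    using AB by (intro sum.cong) auto
  also have "\<dots> = coord ?A u * coord ?B w * ?T ?A ?B"
    using AB by simp
  finally have "?T ?A ?B = 0" using initial_set(2) assms by simp
  moreover have "?T ?A ?B \<noteq> 0"
    using AB CD coord_contracted_product_nonzero_iff[of ?A ?B C ?D] by (auto simp: C_def)
  ultimately show False by simp
qed

theorem hypergraph_initial_hypergraph: "hypergraph n (initial_hypergraph n f W)"
  using initial_set(1) by (auto simp: hypergraph_def initial_hypergraph_def)

theorem t_intersecting_initial_hypergraph:
  assumes "self_annihilating t W"
  shows "t_intersecting t (initial_hypergraph n f W)"
  unfolding t_intersecting_def
proof (intro ballI, rule ccontr)
  fix A B
  assume "A \<in> initial_hypergraph n f W" "B \<in> initial_hypergraph n f W" and less: "\<not> t \<le> card (A \<inter> B)"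
  then obtain u w where u: "u \<in> W" "u \<noteq> 0" "A = initial_set n f u"
    and w: "w \<in> W" "w \<noteq> 0" "B = initial_set n f w"
    by (auto simp: initial_hypergraph_def)
  have "finite (A \<inter> B)" using initial_set(1)[OF u(2)] u(3) by (simp add: finite_index_set)
  then have "decomposable (card (A \<inter> B)) (monomial fd (A \<inter> B))" by (rule decomposable_dual_monomial)
  then have "(u \<llcorner> monomial fd (A \<inter> B)) * (w \<llcorner> monomial fd (A \<inter> B)) = 0"
    using assms u(1) w(1) less unfolding self_annihilating_def not_le by blast
  with contracted_product_nonzero u w show False by blast
qed

end

theorem theorem2p11:
  fixes f :: "nat \<Rightarrow> 'v::real_vector" and n t :: nat
  assumes "ordered_basis n f" and "t > 0"
  shows "(\<forall>\<A>. hypergraph n \<A> \<and> t_intersecting t \<A> \<longrightarrow>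
              self_annihilating t (monomial_subspace f \<A>)) \<and>
         (\<forall>W. self_annihilating t W \<longrightarrow>
              hypergraph n (initial_hypergraph n f W) \<and> t_intersecting t (initial_hypergraph n f W))"
proof -
  interpret exterior_basis n f by unfold_locales (rule assms(1))
  show ?thesis
    using self_annihilating_monomial_subspace hypergraph_initial_hypergraph
      t_intersecting_initial_hypergraph by blast
qed

end
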